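(* Let $f,g_1,\dots,g_m\in\mathbb{R}[\mathbf{x}]$, $\mathbf{X}=\{\mathbf{x}\in\mathbb{R}^n:g_1(\mathbf{x})\ge0,\dots,g_m(\mathbf{x})\ge0\}$, and for $r\ge r_{\min}$ and $s\ge1$ let $f^{r,s}_{\mathrm{ts}}$ be the optimal value of $$\mathbf{P}^{r,s}_{\mathrm{ts}}:\ \inf_{\mathbf{y}}\{L_{\mathbf{y}}(f):\ \mathbf{B}_{G^{(s)}_{r,j}}\circ\mathbf{M}_{r-d_j}(g_j\mathbf{y})\in\Pi_{G^{(s)}_{r,j}}(\mathbb{S}^+_{t_j})\ (j=0,1,\dots,m),\ y_{\mathbf{0}}=1\}$$ and $f^r_{\mathrm{mom}}$ the optimal value of $\inf_{\mathbf{y}}\{L_{\mathbf{y}}(f):\mathbf{M}_{r-d_j}(g_j\mathbf{y})\succeq0\ (j=0,\dots,m),\ y_{\mathbf{0}}=1\}$. Then: (i) if $\mathbf{X}$ has nonempty interior, then for all $r\ge r_{\min}$, $s\ge1$ there is no duality gap between $\mathbf{P}^{r,s}_{\mathrm{ts}}$ and its dual $$\sup_{\mathbf{G}_j,b}\Big\{b:\ \sum_{j=0}^m\langle\mathbf{C}^j_\alpha,\mathbf{G}_j\rangle=f_\alpha-b\,1_{\alpha=\mathbf{0}}\ \ \forall\alpha\in\bigcup_{j=0}^m\big(\operatorname{supp}(g_j)+\operatorname{supp}(G^{(s)}_{r,j})\big),\ \mathbf{G}_j\in\mathbb{S}^+_{t_j}\cap\mathbb{S}(G^{(s)}_{r,j})\Big\};$$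 (ii) for fixed $r\ge r_{\min}$, $(f^{r,s}_{\mathrm{ts}})_{s\ge1}$ is monotonically nondecreasing and $f^{r,s}_{\mathrm{ts}}\le f^r_{\mathrm{mom}}$ for all $s\ge1$; (iii) if the maximal chordal extension is used in the chordal extension operation, then for each $r\ge r_{\min}$ the sequence $(f^{r,s}_{\mathrm{ts}})_{s\ge1}$ reaches $f^r_{\mathrm{mom}}$ after finitely many steps; (iv) for fixed $s\ge1$, $(f^{r,s}_{\mathrm{ts}})_{r\ge r_{\min}}$ is monotonically nondecreasing.
   Context: $g_0=1$, $d_j=\lceil\deg(g_j)/2\rceil$ ($d_0=0$), $r_{\min}=\max\{\lceil\deg(f)/2\rceil,d_1,\dots,d_m\}$, $\mathbb{N}^n_k=\{\alpha\in\mathbb{N}^n:\sum_i\alpha_i\le k\}$, $\mathscr{B}_{r,j}=\mathbb{N}^n_{r-d_j}$, $t_j=|\mathscr{B}_{r,j}|$, $\mathscr{A}=\operatorname{supp}(f)\cup\bigcup_{j=1}^m\operatorname{supp}(g_j)$. $L_{\mathbf{y}}(\sum_\alpha h_\alpha\mathbf{x}^\alpha)=\sum_\alpha h_\alpha y_\alpha$; $\mathbf{M}_{r-d_j}(g_j\mathbf{y})$ is the matrix indexed by $\mathbb{N}^n_{r-d_j}$ with $(\beta,\gamma)$-entry $L_{\mathbf{y}}(g_j\mathbf{x}^{\beta+\gamma})$. $\mathbf{C}^j_\alpha$ is the matrix indexed by $\mathbb{N}^n_{r-d_j}$ with $(\beta,\gamma)$-entry $\sum_{\beta+\gamma+\delta=\alpha}g_{j,\delta}$,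 where $g_j=\sum_\delta g_{j,\delta}\mathbf{x}^\delta$; $f=\sum_\alpha f_\alpha\mathbf{x}^\alpha$. Graphs: a chordal graph has a chord in every cycle of length $\ge4$; a chordal extension $G'$ of $G$ is a chordal graph on the same nodes containing $G$; chordal extensions are fixed so that $G\subseteq H$ (nodes and edges) implies $G'\subseteq H'$; the maximal chordal extension turns each connected component into a clique. For a graph $G$ with nodes $V\subseteq\mathbb{N}^n$, $\operatorname{supp}(G)=\{\beta+\gamma:\beta=\gamma\in V\text{ or }\{\beta,\gamma\}\in E(G)\}$; for $S,T\subseteq\mathbb{N}^n$, $S+T=\{a+b:a\in S,b\in T\}$. Construction: $G^{(0)}_{r,0}$ has nodes $\mathscr{B}_{r,0}$ and edges $\{\beta,\gamma\}$, $\beta\ne\gamma$, with $\beta+\gamma\in\mathscr{A}\cup2\mathscr{B}_{r,0}$; for $j\in[m]$, $G^{(0)}_{r,j}$ is the edgeless graph on $\mathscr{B}_{r,j}$. For $s\ge1$ and $j=0,\dots,m$, $F^{(s)}_{r,j}$ has nodes $\mathscr{B}_{r,j}$ and edges $\{\beta,\gamma\}$, $\beta\ne\gamma$, such that $(\operatorname{supp}(g_j)+\beta+\gamma)\cap\bigcup_{i=0}^m(\operatorname{supp}(g_i)+\operatorname{supp}(G^{(s-1)}_{r,i}))\ne\emptyset$, and $G^{(s)}_{r,j}=(F^{(s)}_{r,j})'$. For a graph $G$ on $V$: $\mathbb{S}(G)$ is the set of symmetric matrices indexed by $V$ vanishing at off-diagonal non-edges; $\Pi_G$ zeroes those entries;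 $\Pi_G(\mathbb{S}^+_{|V|})=\{\Pi_G(\mathbf{Q}):\mathbf{Q}\succeq0\}$; $\mathbf{B}_G$ is the adjacency matrix of $G$ with unit diagonal; $\circ$ is the entrywise product; $\langle\mathbf{A},\mathbf{B}\rangle=\operatorname{tr}(\mathbf{A}\mathbf{B})$. *)

theory Defs
  imports "HOL-Analysis.Analysis"
begin

type_synonym 'n expo = "'n \<Rightarrow> nat"
type_synonym 'n rpoly = "'n expo \<Rightarrow> real"       \<comment> \<open>coefficient function (finite support assumed)\<close>
type_synonym 'a graph = "'a set \<times> 'a set set"   \<comment> \<open>(nodes, edges as 2-element sets)\<close>
type_synonym 'a mfun = "'a \<Rightarrow> 'a \<Rightarrow> real"      \<comment> \<open>matrix, indexed by some node set\<close>

definition psupp :: "'n rpoly \<Rightarrow> 'n expo set" where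
  "psupp p = {\<alpha>. p \<alpha> \<noteq> 0}"

definition tdeg :: "('n::finite) expo \<Rightarrow> nat" where
  "tdeg \<alpha> = (\<Sum>i\<in>UNIV. \<alpha> i)"

definition pdeg :: "('n::finite) rpoly \<Rightarrow> nat" where
  "pdeg p = Max (insert 0 (tdeg ` psupp p))"

definition peval :: "('n::finite) rpoly \<Rightarrow> real ^ 'n \<Rightarrow> real" where
  "peval p x = (\<Sum>\<alpha>\<in>psupp p. p \<alpha> * (\<Prod>i\<in>UNIV. (x $ i) ^ (\<alpha> i)))"

definition zexp :: "'n expo" where
  "zexp = (\<lambda>_. 0)"

definition addexp :: "'n expo \<Rightarrow> 'n expo \<Rightarrow> 'n expo" where
  "addexp a b = (\<lambda>i. a i + b i)"

definition msumset :: "'n expo set \<Rightarrow> 'n expo set \<Rightarrow> 'n expo set" where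
  "msumset S T = {addexp a b | a b. a \<in> S \<and> b \<in> T}"

definition xmon :: "'n expo \<Rightarrow> 'n rpoly" where
  "xmon \<beta> = (\<lambda>\<alpha>. if \<alpha> = \<beta> then 1 else 0)"

definition one_poly :: "'n rpoly" where
  "one_poly = xmon zexp"

definition pmult :: "'n rpoly \<Rightarrow> 'n rpoly \<Rightarrow> 'n rpoly" where
  "pmult p q = (\<lambda>\<alpha>. \<Sum>(a, b) \<in> {(a, b). a \<in> psupp p \<and> b \<in> psupp q \<and> addexp a b = \<alpha>}. p a * q b)"

definition gg :: "(nat \<Rightarrow> 'n rpoly) \<Rightarrow> nat \<Rightarrow> 'n rpoly" where
  "gg g j = (if j = 0 then one_poly else g j)"

definition dj :: "(nat \<Rightarrow> ('n::finite) rpoly) \<Rightarrow> nat \<Rightarrow> nat" where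
  "dj g j = (if j = 0 then 0 else nat \<lceil>real (pdeg (g j)) / 2\<rceil>)"

definition rmin :: "('n::finite) rpoly \<Rightarrow> (nat \<Rightarrow> 'n rpoly) \<Rightarrow> nat \<Rightarrow> nat" where
  "rmin f g m = Max (insert (nat \<lceil>real (pdeg f) / 2\<rceil>) (dj g ` {1..m}))"

definition Nk :: "nat \<Rightarrow> ('n::finite) expo set" where
  "Nk k = {\<alpha>. tdeg \<alpha> \<le> k}"

definition Bset :: "(nat \<Rightarrow> ('n::finite) rpoly) \<Rightarrow> nat \<Rightarrow> nat \<Rightarrow> 'n expo set" where
  "Bset g r j = Nk (r - dj g j)"

definition Aset :: "'n rpoly \<Rightarrow> (nat \<Rightarrow> 'n rpoly) \<Rightarrow> nat \<Rightarrow> 'n expo set" where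
  "Aset f g m = psupp f \<union> (\<Union>j\<in>{1..m}. psupp (g j))"

definition Lfun :: "('n expo \<Rightarrow> real) \<Rightarrow> 'n rpoly \<Rightarrow> real" where
  "Lfun y h = (\<Sum>\<alpha>\<in>psupp h. h \<alpha> * y \<alpha>)"

definition locmat :: "(nat \<Rightarrow> 'n rpoly) \<Rightarrow> nat \<Rightarrow> ('n expo \<Rightarrow> real) \<Rightarrow> 'n expo mfun" where
  "locmat g j y = (\<lambda>\<beta> \<gamma>. Lfun y (pmult (gg g j) (xmon (addexp \<beta> \<gamma>))))"

definition Cmat :: "(nat \<Rightarrow> 'n rpoly) \<Rightarrow> nat \<Rightarrow> 'n expo \<Rightarrow> 'n expo mfun" where
  "Cmat g j \<alpha> = (\<lambda>\<beta> \<gamma>. \<Sum>\<delta>\<in>{\<delta>\<in>psupp (gg g j). addexp (addexp \<beta> \<gamma>) \<delta> = \<alpha>}. gg g j \<delta>)"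

definition psd_on :: "'a set \<Rightarrow> 'a mfun \<Rightarrow> bool" where
  "psd_on V Q \<longleftrightarrow> (\<forall>a\<in>V. \<forall>b\<in>V. Q a b = Q b a) \<and>
     (\<forall>v. 0 \<le> (\<Sum>a\<in>V. \<Sum>b\<in>V. v a * Q a b * v b))"

definition frob :: "'a set \<Rightarrow> 'a mfun \<Rightarrow> 'a mfun \<Rightarrow> real" where
  "frob V A B = (\<Sum>a\<in>V. \<Sum>b\<in>V. A a b * B b a)"

definition had_prod :: "'a mfun \<Rightarrow> 'a mfun \<Rightarrow> 'a mfun" where
  "had_prod A B = (\<lambda>a b. A a b * B a b)"

definition gnodes :: "'a graph \<Rightarrow> 'a set" where "gnodes G = fst G"
definition gedges :: "'a graph \<Rightarrow> 'a set set" where "gedges G = snd G"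

definition wf_graph :: "'a graph \<Rightarrow> bool" where
  "wf_graph G \<longleftrightarrow> (\<forall>e\<in>gedges G. \<exists>a b. e = {a, b} \<and> a \<noteq> b \<and> a \<in> gnodes G \<and> b \<in> gnodes G)"

definition subgraph :: "'a graph \<Rightarrow> 'a graph \<Rightarrow> bool" where
  "subgraph G H \<longleftrightarrow> gnodes G \<subseteq> gnodes H \<and> gedges G \<subseteq> gedges H"

definition chordal :: "'a graph \<Rightarrow> bool" where
  "chordal G \<longleftrightarrow> (\<forall>cs. distinct cs \<and> length cs \<ge> 4 \<and> set cs \<subseteq> gnodes G \<and>
      (\<forall>i<length cs. {cs ! i, cs ! ((i + 1) mod length cs)} \<in> gedges G) \<longrightarrow>
      (\<exists>i<length cs. \<exists>k<length cs. i \<noteq> k \<and> k \<noteq> (i + 1) mod length cs \<and>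
          i \<noteq> (k + 1) mod length cs \<and> {cs ! i, cs ! k} \<in> gedges G))"

definition chordal_ext_op :: "('a graph \<Rightarrow> 'a graph) \<Rightarrow> bool" where
  "chordal_ext_op ext \<longleftrightarrow>
     (\<forall>G. wf_graph G \<longrightarrow> wf_graph (ext G) \<and> chordal (ext G) \<and>
        gnodes (ext G) = gnodes G \<and> gedges G \<subseteq> gedges (ext G)) \<and>
     (\<forall>G H. wf_graph G \<and> wf_graph H \<and> subgraph G H \<longrightarrow> subgraph (ext G) (ext H))"

definition adjrel :: "'a graph \<Rightarrow> ('a \<times> 'a) set" where
  "adjrel G = {(a, b). {a, b} \<in> gedges G}"

definition max_chordal_ext :: "'a graph \<Rightarrow> 'a graph" where
  "max_chordal_ext G = (gnodes G,
     {{a, b} | a b. a \<in> gnodes G \<and> b \<in> gnodes G \<and> a \<noteq> b \<and> (a, b) \<in> (adjrel G)\<^sup>*})"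

definition in_SG :: "'a graph \<Rightarrow> 'a mfun \<Rightarrow> bool" where
  "in_SG G Q \<longleftrightarrow> (\<forall>a\<in>gnodes G. \<forall>b\<in>gnodes G. Q a b = Q b a) \<and>
     (\<forall>a\<in>gnodes G. \<forall>b\<in>gnodes G. a \<noteq> b \<and> {a, b} \<notin> gedges G \<longrightarrow> Q a b = 0)"

definition projG :: "'a graph \<Rightarrow> 'a mfun \<Rightarrow> 'a mfun" where
  "projG G Q = (\<lambda>a b. if a = b \<or> {a, b} \<in> gedges G then Q a b else 0)"

definition Bmat :: "'a graph \<Rightarrow> 'a mfun" where
  "Bmat G = (\<lambda>a b. if a = b \<or> {a, b} \<in> gedges G then 1 else 0)"

definition in_proj_psd :: "'a graph \<Rightarrow> 'a mfun \<Rightarrow> bool" where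
  "in_proj_psd G M \<longleftrightarrow> (\<exists>Q. psd_on (gnodes G) Q \<and>
      (\<forall>a\<in>gnodes G. \<forall>b\<in>gnodes G. M a b = projG G Q a b))"

definition gsupp :: "'n expo graph \<Rightarrow> 'n expo set" where
  "gsupp G = {addexp b c | b c. (b = c \<and> b \<in> gnodes G) \<or> {b, c} \<in> gedges G}"

definition G0 :: "('n::finite) rpoly \<Rightarrow> (nat \<Rightarrow> 'n rpoly) \<Rightarrow> nat \<Rightarrow> nat \<Rightarrow> 'n expo graph" where
  "G0 f g m r = (Bset g r 0,
     {{b, c} | b c. b \<in> Bset g r 0 \<and> c \<in> Bset g r 0 \<and> b \<noteq> c \<and>
        addexp b c \<in> Aset f g m \<union> (\<lambda>a. addexp a a) ` Bset g r 0})"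

definition Fgraph :: "(nat \<Rightarrow> ('n::finite) rpoly) \<Rightarrow> nat \<Rightarrow> nat \<Rightarrow> (nat \<Rightarrow> 'n expo graph) \<Rightarrow> nat \<Rightarrow> 'n expo graph" where
  "Fgraph g m r Gp j = (Bset g r j,
     {{b, c} | b c. b \<in> Bset g r j \<and> c \<in> Bset g r j \<and> b \<noteq> c \<and>
        msumset (psupp (gg g j)) {addexp b c} \<inter>
          (\<Union>i\<in>{0..m}. msumset (psupp (gg g i)) (gsupp (Gp i))) \<noteq> {}})"

primrec tsg :: "('n expo graph \<Rightarrow> 'n expo graph) \<Rightarrow> ('n::finite) rpoly \<Rightarrow> (nat \<Rightarrow> 'n rpoly) \<Rightarrow> nat \<Rightarrow> nat \<Rightarrow> nat \<Rightarrow> nat \<Rightarrow> 'n expo graph" where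
  "tsg ext f g m r 0 = (\<lambda>j. if j = 0 then G0 f g m r else (Bset g r j, {}))"
| "tsg ext f g m r (Suc s) = (\<lambda>j. ext (Fgraph g m r (tsg ext f g m r s) j))"

definition ts_feasible where
  "ts_feasible ext f g m r s y \<longleftrightarrow> y zexp = 1 \<and>
     (\<forall>j\<in>{0..m}. in_proj_psd (tsg ext f g m r s j)
         (had_prod (Bmat (tsg ext f g m r s j)) (locmat g j y)))"

definition ts_val :: "('n expo graph \<Rightarrow> 'n expo graph) \<Rightarrow> ('n::finite) rpoly \<Rightarrow> (nat \<Rightarrow> 'n rpoly) \<Rightarrow> nat \<Rightarrow> nat \<Rightarrow> nat \<Rightarrow> ereal" where
  "ts_val ext f g m r s = (INF y\<in>{y. ts_feasible ext f g m r s y}. ereal (Lfun y f))"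

definition ts_dual_feasible where
  "ts_dual_feasible ext f g m r s Gs b \<longleftrightarrow>
     (\<forall>j\<in>{0..m}. psd_on (Bset g r j) (Gs j) \<and> in_SG (tsg ext f g m r s j) (Gs j)) \<and>
     (\<forall>\<alpha>\<in>(\<Union>j\<in>{0..m}. msumset (psupp (gg g j)) (gsupp (tsg ext f g m r s j))).
        (\<Sum>j=0..m. frob (Bset g r j) (Cmat g j \<alpha>) (Gs j)) = f \<alpha> - (if \<alpha> = zexp then b else 0))"

definition ts_dual_val :: "('n expo graph \<Rightarrow> 'n expo graph) \<Rightarrow> ('n::finite) rpoly \<Rightarrow> (nat \<Rightarrow> 'n rpoly) \<Rightarrow> nat \<Rightarrow> nat \<Rightarrow> nat \<Rightarrow> ereal" where
  "ts_dual_val ext f g m r s =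
     (SUP (Gs, b)\<in>{(Gs, b). ts_dual_feasible ext f g m r s Gs b}. ereal b)"

definition mom_feasible where
  "mom_feasible g m r y \<longleftrightarrow> y zexp = 1 \<and>
     (\<forall>j\<in>{0..m}. psd_on (Bset g r j) (locmat g j y))"

definition mom_val :: "('n::finite) rpoly \<Rightarrow> (nat \<Rightarrow> 'n rpoly) \<Rightarrow> nat \<Rightarrow> nat \<Rightarrow> ereal" where
  "mom_val f g m r = (INF y\<in>{y. mom_feasible g m r y}. ereal (Lfun y f))"

definition semialg_set :: "(nat \<Rightarrow> ('n::finite) rpoly) \<Rightarrow> nat \<Rightarrow> (real ^ 'n) set" where
  "semialg_set g m = {x. \<forall>j\<in>{1..m}. 0 \<le> peval (g j) x}"

end

theory Submission
  imports Defs
begin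

text \<open>
  Parts (ii) and (iv) hold because enlarging the graphs, by increasing s or r, only adds constraints,
  and a positive semidefinite localizing matrix is its own completion. For (iii), the finitely many
  possible edges force the graphs to stabilize. Their components are then cliques, and after setting
  to zero all moments outside the support, a feasible vector has block-diagonal localizing matrices,
  so it is feasible for the dense relaxation. For (i), the moments of a uniform measure on a fine
  grid in the interior of the feasible set satisfy Slater's condition. Separating the origin from
  the convex set of all constraint residuals paired with the objective excess then yields a dual
  solution without gap; no closedness is needed, because separation takes place in finite dimension.
\<close>

section \<open>Positive semidefinite matrices\<close>

text \<open>Feasibility is read throughout as a completion problem: some semidefinite
  \<open>Q\<close> agrees with the localizing matrix on the diagonal and on the edges. For (iii) the
  decisive point is a dichotomy. A retained entry has all its exponents in the support; once the
  graphs are stable, an absent entry has none, since a single common exponent would already have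
  created an edge. Filling with zeros then preserves semidefiniteness because, for the maximal
  extension, edges and diagonal together form an equivalence relation. For (i) the danger is a
  separating functional that gives the objective weight zero. It is excluded at the Slater point:
  there every localizing matrix of a nonzero constraint is positive definite as a whole, and such a
  matrix pairs strictly positively with any nonzero semidefinite multiplier.\<close>

abbreviation quad_form :: "'a set \<Rightarrow> 'a mfun \<Rightarrow> ('a \<Rightarrow> real) \<Rightarrow> real" where
  "quad_form V Q v \<equiv> \<Sum>a\<in>V. \<Sum>b\<in>V. v a * Q a b * v b"

lemma psd_on_sym: "psd_on V Q \<Longrightarrow> a \<in> V \<Longrightarrow> b \<in> V \<Longrightarrow> Q a b = Q b a"
  unfolding psd_on_def by blast

lemma psd_on_quad_form_nonneg: "psd_on V Q \<Longrightarrow> 0 \<le> quad_form V Q v"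
  unfolding psd_on_def by blast

lemma quad_form_insert:
  assumes "finite V" "k \<notin> V" and sym: "\<And>a. a \<in> V \<Longrightarrow> Q a k = Q k a"
  shows "quad_form (insert k V) Q v = v k * v k * Q k k + 2 * v k * (\<Sum>a\<in>V. Q k a * v a) + quad_form V Q v"
proof -
  have "(\<Sum>a\<in>V. v a * Q a k * v k) = v k * (\<Sum>a\<in>V. Q k a * v a)"
    unfolding sum_distrib_left by (rule sum.cong) (auto simp: sym)
  moreover have "(\<Sum>b\<in>V. v k * Q k b * v b) = v k * (\<Sum>a\<in>V. Q k a * v a)"
    unfolding sum_distrib_left by (rule sum.cong) auto
  ultimately show ?thesis
    using assms by (simp add: sum.distrib algebra_simps)
qed

lemma quad_form_cong:
  assumes "\<And>a. a \<in> V \<Longrightarrow> v a = w a" "\<And>a b. a \<in> V \<Longrightarrow> b \<in> V \<Longrightarrow> Q a b = R a b"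
  shows "quad_form V Q v = quad_form V R w"
  using assms by (intro sum.cong) auto

text \<open>Letting \<open>t\<close> tend to infinity. This lemma and the next two turn an
  inequality valid along a ray or a line into sign conditions, which is how the duality proof
  obtains its multipliers.\<close>

lemma linear_nonneg_imp_slope_nonneg:
  fixes A B :: real
  assumes "\<And>t. t > 0 \<Longrightarrow> 0 \<le> A + t * B"
  shows "0 \<le> B"
proof (rule ccontr)
  assume "\<not> 0 \<le> B"
  then have B: "B < 0" by simp
  define t where "t = (\<bar>A\<bar> + 1) / (- B)"
  have "t > 0" "t * B = - (\<bar>A\<bar> + 1)" using B by (auto simp: t_def field_simps)
  then show False using assms[of t] by linarith
qed

lemma linear_nonneg_imp_const_nonneg:
  fixes A B :: real
  assumes "\<And>t. t > 0 \<Longrightarrow> 0 \<le> A + t * B"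
  shows "0 \<le> A"
proof -
  have "0 \<le> B + t * A" if "t > 0" for t
    using assms[of "1 / t"] that by (simp add: field_simps)
  then show ?thesis by (rule linear_nonneg_imp_slope_nonneg)
qed

lemma affine_nonneg_imp_slope_0:
  fixes A B :: real
  assumes "\<And>t. 0 \<le> A + t * B"
  shows "B = 0"
proof -
  have "0 \<le> A + t * (- B)" for t using assms[of "- t"] by simp
  then have "0 \<le> - B" by (rule linear_nonneg_imp_slope_nonneg)
  moreover have "0 \<le> B" by (rule linear_nonneg_imp_slope_nonneg) (rule assms)
  ultimately show ?thesis by simp
qed

lemma psd_on_subset:
  assumes "psd_on V Q" "U \<subseteq> V" "finite V"
  shows "psd_on U Q"
proof -
  have "0 \<le> quad_form U Q v" for v
  proof -
    define w where "w = (\<lambda>a. if a \<in> U then v a else 0)"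
    have "quad_form V Q w = (\<Sum>a\<in>U. \<Sum>b\<in>V. w a * Q a b * w b)"
      by (rule sum.mono_neutral_right) (use assms in \<open>auto simp: w_def\<close>)
    also have "\<dots> = quad_form U Q w"
      by (intro sum.cong sum.mono_neutral_right) (use assms in \<open>auto simp: w_def\<close>)
    also have "\<dots> = quad_form U Q v"
      by (rule quad_form_cong) (auto simp: w_def)
    finally show ?thesis using psd_on_quad_form_nonneg[OF assms(1), of w] by simp
  qed
  then show ?thesis using assms unfolding psd_on_def by blast
qed

text \<open>The vector with entry \<open>t\<close> at \<open>k\<close> and 1 at \<open>a\<close>
  gives a form that is affine in \<open>t\<close>, because the quadratic term carries
  \<open>Q k k\<close>; an affine function that is nonnegative on the whole line is
  constant.\<close>

lemma psd_on_diag_zero: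
  assumes psd: "psd_on V Q" and "finite V" "k \<in> V" "a \<in> V" and zero: "Q k k = 0"
  shows "Q k a = 0"
proof (cases "a = k")
  case False
  have "0 \<le> Q a a + t * (2 * Q k a)" for t
  proof -
    define v where "v = (\<lambda>b. if b = k then t else 1::real)"
    have "psd_on {k, a} Q" using psd_on_subset[OF psd] assms by simp
    from psd_on_quad_form_nonneg[OF this, of v] psd_on_sym[OF this, of a k] False zero show ?thesis by (simp add: v_def algebra_simps)
  qed
  then have "2 * Q k a = 0" by (rule affine_nonneg_imp_slope_0)
  then show ?thesis by simp
qed (use zero in simp)

text \<open>Cholesky elimination: the rank-one part of the pivot row \<open>k\<close> is split off
  and the Schur complement \<open>Q'\<close> is factored. With a zero pivot the row of
  \<open>k\<close> vanishes, and since division by zero yields 0 the same formulas apply.\<close>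

lemma psd_on_gram:
  assumes "finite V" "psd_on V Q"
  shows "\<exists>u. \<forall>a\<in>V. \<forall>b\<in>V. Q a b = (\<Sum>k\<in>V. u k a * u k b)"
  using assms
proof (induction V arbitrary: Q rule: finite_induct)
  case empty
  then show ?case by simp
next
  case (insert k V)
  define c where "c = Q k k"
  have sym: "Q a b = Q b a" if "a \<in> insert k V" "b \<in> insert k V" for a b
    using psd_on_sym[OF insert.prems] that .
  note form = psd_on_quad_form_nonneg[OF insert.prems]
  have "psd_on {k} Q" by (rule psd_on_subset[OF insert.prems]) (use insert in auto)
  from psd_on_quad_form_nonneg[OF this, of "\<lambda>_. 1"] have "c \<ge> 0"
    by (simp add: c_def)
  have zero: "Q k a = 0" if "c = 0" "a \<in> insert k V" for a
    using psd_on_diag_zero[OF insert.prems] insert.hyps that by (simp add: c_def)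
  define Q' where "Q' a b = Q a b - Q k a * Q k b / c" for a b
  have "psd_on V Q'"
    unfolding psd_on_def
  proof (intro conjI ballI allI)
    show "Q' a b = Q' b a" if "a \<in> V" "b \<in> V" for a b
      using sym that by (simp add: Q'_def)
    fix v
    define S where "S = (\<Sum>a\<in>V. Q k a * v a)"
    \<comment> \<open>For \<open>c > 0\<close> this value at \<open>k\<close> minimizes the form of
      \<open>Q\<close> with \<open>v\<close> fixed on \<open>V\<close>, and the minimum is the form
      of the Schur complement.\<close>
    define w where "w = v(k := - S / c)"
    have wV: "w a = v a" if "a \<in> V" for a using that insert.hyps by (auto simp: w_def)
    have "(\<Sum>a\<in>V. \<Sum>b\<in>V. v a * (Q k a * Q k b / c) * v b) = S * S / c"
      unfolding S_def sum_product by (simp add: sum_divide_distrib mult_ac)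
    then have "quad_form V Q' v = quad_form V Q v - S * S / c"
      by (simp add: Q'_def algebra_simps sum_subtractf)
    also have "\<dots> = w k * w k * c + 2 * w k * (\<Sum>a\<in>V. Q k a * w a) + quad_form V Q w"
    proof -
      have "(\<Sum>a\<in>V. Q k a * w a) = S" unfolding S_def by (rule sum.cong) (auto simp: wV)
      moreover have "quad_form V Q w = quad_form V Q v" by (rule quad_form_cong) (auto simp: wV)
      ultimately show ?thesis by (cases "c = 0") (auto simp: w_def field_simps)
    qed
    also have "\<dots> = quad_form (insert k V) Q w"
      by (subst quad_form_insert) (use insert.hyps sym in \<open>auto simp: c_def\<close>)
    finally show "0 \<le> quad_form V Q' v" using form by simp
  qed
  then obtain u where u: "\<And>a b. a \<in> V \<Longrightarrow> b \<in> V \<Longrightarrow> Q' a b = (\<Sum>k\<in>V. u k a * u k b)"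
    using insert.IH by blast
  \<comment> \<open>The new row is the pivot row over the square root of the pivot; the old rows get
    entry 0 at \<open>k\<close> and so contribute nothing to the row and column of
    \<open>k\<close>.\<close>
  define u' where "u' i a = (if i = k then Q k a / sqrt c else if a = k then 0 else u i a)" for i a
  have "Q a b = (\<Sum>i\<in>insert k V. u' i a * u' i b)" if ab: "a \<in> insert k V" "b \<in> insert k V" for a b
  proof -
    have "(\<Sum>i\<in>insert k V. u' i a * u' i b) = Q k a * Q k b / c + (\<Sum>i\<in>V. u' i a * u' i b)"
      using insert.hyps \<open>c \<ge> 0\<close> by (simp add: u'_def)
    also have "(\<Sum>i\<in>V. u' i a * u' i b) = (if a = k \<or> b = k then 0 else Q' a b)"
      using ab insert.hyps by (auto simp: u'_def u intro!: sum.cong sum.neutral)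
    finally show ?thesis
      using ab zero sym[of a k] by (cases "c = 0") (auto simp: Q'_def c_def)
  qed
  then show ?case by blast
qed

lemma sum_prod_gram:
  assumes "\<And>a b. a \<in> V \<Longrightarrow> b \<in> V \<Longrightarrow> R a b = (\<Sum>k\<in>V. u k a * u k b)"
  shows "(\<Sum>a\<in>V. \<Sum>b\<in>V. Q a b * R a b) = (\<Sum>k\<in>V. quad_form V Q (u k))"
proof -
  have "(\<Sum>a\<in>V. \<Sum>b\<in>V. Q a b * R a b) = (\<Sum>a\<in>V. \<Sum>b\<in>V. \<Sum>k\<in>V. u k a * Q a b * u k b)"
    by (intro sum.cong) (auto simp: assms sum_distrib_left mult_ac)
  also have "\<dots> = (\<Sum>a\<in>V. \<Sum>k\<in>V. \<Sum>b\<in>V. u k a * Q a b * u k b)"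
    by (intro sum.cong refl sum.swap)
  also have "\<dots> = (\<Sum>k\<in>V. quad_form V Q (u k))" by (rule sum.swap)
  finally show ?thesis .
qed

text \<open>Each Gram row of \<open>R\<close> contributes one value of the quadratic form of
  \<open>Q\<close>. This pairing is the source of weak duality.\<close>

lemma psd_on_sum_prod_nonneg:
  assumes "finite V" "psd_on V Q" "psd_on V R"
  shows "0 \<le> (\<Sum>a\<in>V. \<Sum>b\<in>V. Q a b * R a b)"
proof -
  obtain u where "\<forall>a\<in>V. \<forall>b\<in>V. R a b = (\<Sum>k\<in>V. u k a * u k b)"
    using psd_on_gram assms by blast
  then have "(\<Sum>a\<in>V. \<Sum>b\<in>V. Q a b * R a b) = (\<Sum>k\<in>V. quad_form V Q (u k))"
    by (intro sum_prod_gram) auto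
  also have "\<dots> \<ge> 0" by (intro sum_nonneg psd_on_quad_form_nonneg assms)
  finally show ?thesis .
qed

text \<open>A nonzero entry of \<open>R\<close> forces a Gram row that does not vanish, and this row
  contributes a strictly positive term. In the duality proof this rules out a zero weight on the
  objective.\<close>

lemma pos_def_sum_prod_pos:
  assumes "finite V" and pos: "\<And>v. \<exists>a\<in>V. v a \<noteq> 0 \<Longrightarrow> 0 < quad_form V Q v"
    and "psd_on V R" and nz: "a \<in> V" "b \<in> V" "R a b \<noteq> 0"
  shows "0 < (\<Sum>a\<in>V. \<Sum>b\<in>V. Q a b * R a b)"
proof -
  obtain u where u: "\<forall>a\<in>V. \<forall>b\<in>V. R a b = (\<Sum>k\<in>V. u k a * u k b)"
    using psd_on_gram assms by blast
  have nonneg: "0 \<le> quad_form V Q v" for v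
  proof (cases "\<exists>a\<in>V. v a \<noteq> 0")
    case False
    then show ?thesis by simp
  qed (use pos[of v] in simp)
  obtain k where k: "k \<in> V" "u k a \<noteq> 0"
  proof -
    have "(\<Sum>k\<in>V. u k a * u k b) \<noteq> 0" using nz u by simp
    then obtain k where "k \<in> V" "u k a * u k b \<noteq> 0" by (rule sum.not_neutral_contains_not_neutral)
    with that show ?thesis by simp
  qed
  have "0 < (\<Sum>k\<in>V. quad_form V Q (u k))"
    by (rule sum_pos2[of V k]) (use assms(1) k nz pos nonneg in auto)
  also have "\<dots> = (\<Sum>a\<in>V. \<Sum>b\<in>V. Q a b * R a b)"
    using u by (intro sum_prod_gram[symmetric]) auto
  finally show ?thesis .
qed

section \<open>Outer products, symmetrization and restriction to diagonal blocks\<close>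

lemma psd_on_outer: "psd_on V (\<lambda>a b. v a * v b)"
proof -
  have "quad_form V (\<lambda>a b. v a * v b) w = (\<Sum>a\<in>V. v a * w a) * (\<Sum>a\<in>V. v a * w a)" for w
    by (simp add: sum_product mult_ac)
  then show ?thesis unfolding psd_on_def by (simp add: mult_ac)
qed

lemma psd_on_symmetrization:
  assumes "\<And>v. 0 \<le> quad_form V Q v"
  shows "psd_on V (\<lambda>a b. (Q a b + Q b a) / 2)"
proof -
  have "quad_form V (\<lambda>a b. (Q a b + Q b a) / 2) v = quad_form V Q v" for v
  proof -
    have "quad_form V (\<lambda>a b. Q b a) v = quad_form V Q v"
      by (subst sum.swap) (simp add: mult_ac)
    moreover have "quad_form V (\<lambda>a b. (Q a b + Q b a) / 2) v
        = (quad_form V Q v + quad_form V (\<lambda>a b. Q b a) v) / 2"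
      by (simp add: sum.distrib[symmetric] sum_divide_distrib add_divide_distrib algebra_simps)
    ultimately show ?thesis by simp
  qed
  then show ?thesis using assms by (simp add: psd_on_def add.commute)
qed

lemma psd_on_cong:
  assumes "psd_on V Q" "\<And>a b. a \<in> V \<Longrightarrow> b \<in> V \<Longrightarrow> R a b = Q a b"
  shows "psd_on V R"
proof -
  have "quad_form V R v = quad_form V Q v" for v
    by (rule quad_form_cong) (use assms(2) in auto)
  then show ?thesis using assms unfolding psd_on_def by simp
qed

text \<open>Restricting \<open>v\<close> to each colour class of \<open>c\<close> and adding the
  resulting forms keeps exactly the entries within one class. The colours will be connected
  components.\<close>

lemma psd_on_blocks:
  assumes "finite V" "psd_on V Q"
  shows "psd_on V (\<lambda>a b. if c a = c b then Q a b else 0)"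
  unfolding psd_on_def
proof (intro conjI ballI allI)
  show "(if c a = c b then Q a b else 0) = (if c b = c a then Q b a else 0)" if "a \<in> V" "b \<in> V" for a b
    using psd_on_sym[OF assms(2) that] by simp
  fix v
  have "0 \<le> (\<Sum>C\<in>c ` V. quad_form V Q (\<lambda>a. if c a = C then v a else 0))"
    by (rule sum_nonneg) (rule psd_on_quad_form_nonneg[OF assms(2)])
  also have "\<dots>
      = (\<Sum>a\<in>V. \<Sum>C\<in>c ` V. \<Sum>b\<in>V. (if c a = C then v a else 0) * Q a b * (if c b = C then v b else 0))"
    by (rule sum.swap)
  also have "\<dots> = (\<Sum>a\<in>V. \<Sum>b\<in>V. \<Sum>C\<in>c ` V. (if c a = C then v a else 0) * Q a b * (if c b = C then v b else 0))"
    by (intro sum.cong refl sum.swap)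
  also have "\<dots> = quad_form V (\<lambda>a b. if c a = c b then Q a b else 0) v"
  proof (intro sum.cong refl)
    fix a b assume "a \<in> V" "b \<in> V"
    have "(\<Sum>C\<in>c ` V. (if c a = C then v a else 0) * Q a b * (if c b = C then v b else 0))
        = (\<Sum>C\<in>c ` V. if c a = C then if c b = c a then v a * Q a b * v b else 0 else 0)"
      by (intro sum.cong) auto
    also have "\<dots> = v a * (if c a = c b then Q a b else 0) * v b"
      using assms(1) \<open>a \<in> V\<close> by (auto simp: sum.delta')
    finally show "(\<Sum>C\<in>c ` V. (if c a = C then v a else 0) * Q a b * (if c b = C then v b else 0))
        = v a * (if c a = c b then Q a b else 0) * v b" .
  qed
  finally show "0 \<le> quad_form V (\<lambda>a b. if c a = c b then Q a b else 0) v" .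
qed

section \<open>Separation and conic duality\<close>

text \<open>Induction on the coordinates, as in the extension step of Hahn-Banach: a functional for
  the slice where the new coordinate is 0 is extended by one coefficient. Points are plain functions
  of which only the coordinates in \<open>I\<close> count.\<close>

lemma convex_separate_0:
  fixes S :: "('a \<Rightarrow> real) set"
  assumes "finite I" "S \<noteq> {}"
    and conv: "\<And>x y u v. x \<in> S \<Longrightarrow> y \<in> S \<Longrightarrow> 0 \<le> u \<Longrightarrow> 0 \<le> v \<Longrightarrow> u + v = 1 \<Longrightarrow>
                 (\<lambda>i. u * x i + v * y i) \<in> S"
    and "\<And>x. x \<in> S \<Longrightarrow> \<exists>i\<in>I. x i \<noteq> 0"
  shows "\<exists>a. (\<exists>i\<in>I. a i \<noteq> 0) \<and> (\<forall>x\<in>S. 0 \<le> (\<Sum>i\<in>I. a i * x i))"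
  using assms
proof (induction I arbitrary: S rule: finite_induct)
  case empty
  then show ?case by auto
next
  case (insert k I)
  note conv = insert.prems(2)
  let ?T = "{x \<in> S. x k = 0}"
  \<comment> \<open>For the case that the new coordinate does not change sign on \<open>S\<close>:
    up to sign, that coordinate separates by itself.\<close>
  have unit: ?case if "c \<noteq> 0" "\<And>x. x \<in> S \<Longrightarrow> 0 \<le> c * x k" for c :: real
  proof -
    let ?a = "\<lambda>i. if i = k then c else 0"
    have "(\<Sum>i\<in>insert k I. ?a i * x i) = c * x k" for x :: "'a \<Rightarrow> real"
      using insert.hyps by (simp add: if_distrib[of "\<lambda>t. t * _"] cong: if_cong)
    then show ?thesis using that by (intro exI[of _ ?a]) auto
  qed
  show ?case
  proof (cases "(\<exists>x\<in>S. x k > 0) \<and> (\<exists>x\<in>S. x k < 0)")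
    case False
    then consider "\<forall>x\<in>S. x k \<le> 0" | "\<forall>x\<in>S. x k \<ge> 0" by force
    then show ?thesis using unit[of 1] unit[of "-1"] by cases auto
  next
    case True
    \<comment> \<open>the point where the segment from x to z meets the hyperplane of the k-th coordinate\<close>
    define cross where "cross x z = (\<lambda>i. (- z k / (x k - z k)) * x i + (x k / (x k - z k)) * z i)"
      for x z :: "'a \<Rightarrow> real"
    have cross: "cross x z \<in> ?T" if "x \<in> S" "z \<in> S" "x k > 0" "z k < 0" for x z
    proof -
      have "- z k / (x k - z k) + x k / (x k - z k) = 1"
        using that by (simp flip: diff_divide_distrib)
      then have "cross x z \<in> S" unfolding cross_def using that
        by (intro conv) (auto simp: divide_nonpos_pos)
      then show ?thesis by (simp add: cross_def)
    qed
    have "\<exists>a. (\<exists>i\<in>I. a i \<noteq> 0) \<and> (\<forall>x\<in>?T. 0 \<le> (\<Sum>i\<in>I. a i * x i))"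
    proof (rule insert.IH)
      show "?T \<noteq> {}" using True cross by blast
      show "\<exists>i\<in>I. x i \<noteq> 0" if "x \<in> ?T" for x
        using insert.prems(3)[of x] that by auto
    qed (use conv in auto)
    then obtain a where a: "\<exists>i\<in>I. a i \<noteq> 0" "\<And>x. x \<in> ?T \<Longrightarrow> 0 \<le> (\<Sum>i\<in>I. a i * x i)"
      by blast
    define A where "A x = (\<Sum>i\<in>I. a i * x i)" for x
    \<comment> \<open>\<open>A\<close> is nonnegative where a segment crosses the hyperplane. Hence
      every lower bound on the new coefficient, coming from a point with positive coordinate, is at
      most every upper bound, coming from a point with negative coordinate; the supremum of the
      lower bounds is admissible.\<close>
    have bound: "- A x / x k \<le> A z / (- z k)" if "x \<in> S" "z \<in> S" "x k > 0" "z k < 0" for x z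
    proof -
      have "0 \<le> A (cross x z)" using a(2)[OF cross[OF that]] by (simp add: A_def)
      also have "A (cross x z) = (- z k / (x k - z k)) * A x + (x k / (x k - z k)) * A z"
        unfolding A_def cross_def sum_distrib_left sum.distrib[symmetric]
        by (intro sum.cong) (auto simp: algebra_simps)
      also have "\<dots> = (- z k * A x + x k * A z) / (x k - z k)"
        by (simp add: diff_divide_distrib add_divide_distrib)
      finally have "0 \<le> - z k * A x + x k * A z"
        using that by (simp add: zero_le_divide_iff)
      then show ?thesis using that by (simp add: field_simps)
    qed
    define c where "c = (SUP x\<in>{x\<in>S. x k > 0}. - A x / x k)"
    have bdd: "bdd_above ((\<lambda>x. - A x / x k) ` {x\<in>S. x k > 0})"
      using True bound unfolding bdd_above_def by fastforce
    have lower: "- A x / x k \<le> c" if "x \<in> S" "x k > 0" for x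
      unfolding c_def using that by (intro cSUP_upper bdd) auto
    have upper: "c \<le> A z / (- z k)" if "z \<in> S" "z k < 0" for z
      unfolding c_def using that True bound by (intro cSUP_least) auto
    have ext: "0 \<le> A x + c * x k" if "x \<in> S" for x
    proof -
      consider "x k > 0" | "x k < 0" | "x k = 0" by linarith
      then show ?thesis
      proof cases
        case 1
        with lower[OF that] show ?thesis by (simp add: field_simps)
      next
        case 2
        with upper[OF that] show ?thesis by (simp add: field_simps)
      next
        case 3
        with a(2)[of x] that show ?thesis by (simp add: A_def)
      qed
    qed
    have "(\<Sum>i\<in>insert k I. (a(k := c)) i * x i) = A x + c * x k" for x
      using insert.hyps by (auto simp: A_def intro!: sum.cong)
    moreover have "\<exists>i\<in>insert k I. (a(k := c)) i \<noteq> 0"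
      using a(1) insert.hyps by fastforce
    ultimately show ?thesis using ext by (intro exI[of _ "a(k := c)"]) auto
  qed
qed

text \<open>Entrywise pairing without the transposition in \<open>frob\<close>; the two agree as
  soon as one argument is symmetric.\<close>

abbreviation mat_inner :: "'a set \<Rightarrow> 'a mfun \<Rightarrow> 'a mfun \<Rightarrow> real" where
  "mat_inner V A B \<equiv> \<Sum>a\<in>V. \<Sum>b\<in>V. A a b * B a b"

text \<open>Semidefinite duality with sparsity patterns \<open>E j\<close>: a lower bound
  \<open>p\<close> on the primal objective is reached by a dual solution. The dual matrices are the
  coefficients of a separating functional, with reversed sign and divided by its weight
  \<open>l\<close> on the objective. \<open>y0\<close> with the positive definite completions
  \<open>Q0 j\<close> is the Slater point.\<close>

lemma conic_duality_dual_solution: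
  fixes c :: "'j \<Rightarrow> 'v \<Rightarrow> 'v \<Rightarrow> 'w \<Rightarrow> real" and f :: "'w \<Rightarrow> real" and p :: real and W :: "'w set"
  defines "lin \<equiv> \<lambda>j y a b. \<Sum>w\<in>W. c j a b w * y w"
  assumes "finite J" "\<And>j. j \<in> J \<Longrightarrow> finite (V j)" "finite W" "z \<in> W"
    and E: "\<And>j. j \<in> J \<Longrightarrow> E j \<subseteq> V j \<times> V j" "\<And>j a b. j \<in> J \<Longrightarrow> (a, b) \<in> E j \<Longrightarrow> (b, a) \<in> E j"
    and c: "\<And>j a b w. j \<in> J \<Longrightarrow> c j a b w = c j b a w"
    and slater: "y0 z = 1"
      "\<And>j v. j \<in> J \<Longrightarrow> \<exists>a\<in>V j. v a \<noteq> 0 \<Longrightarrow> 0 < quad_form (V j) (Q0 j) v"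
      "\<And>j a b. j \<in> J \<Longrightarrow> (a, b) \<in> E j \<Longrightarrow> lin j y0 a b = Q0 j a b"
    and bound: "\<And>y. y z = 1 \<Longrightarrow>
      (\<And>j. j \<in> J \<Longrightarrow> \<exists>Q. psd_on (V j) Q \<and> (\<forall>(a, b)\<in>E j. lin j y a b = Q a b)) \<Longrightarrow>
      p \<le> (\<Sum>w\<in>W. f w * y w)"
  shows "\<exists>H b. p \<le> b \<and> (\<forall>j\<in>J. psd_on (V j) (H j) \<and> (\<forall>a b. (a, b) \<notin> E j \<longrightarrow> H j a b = 0)) \<and>
     (\<forall>w\<in>W. (\<Sum>j\<in>J. \<Sum>a\<in>V j. \<Sum>b\<in>V j. c j a b w * H j b a) = f w - (if w = z then b else 0))"
proof -
  define obj where "obj y = (\<Sum>w\<in>W. f w * y w)" for y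
  define nonneg where "nonneg Q \<longleftrightarrow> (\<forall>j\<in>J. \<forall>v. 0 \<le> quad_form (V j) (Q j) v)" for Q
  \<comment> \<open>the matrices Q are not required to be symmetric, which forces the multipliers to be symmetric\<close>
  define S where "S = {x. \<exists>y Q s. y z = 1 \<and> nonneg Q \<and> s > 0 \<and>
     (\<forall>j\<in>J. \<forall>(a, b)\<in>E j. x (Some (j, a, b)) = lin j y a b - Q j a b) \<and> x None = obj y - p + s}"
  define I where "I = insert None (Some ` Sigma J E)"
  have finE: "finite (E j)" if "j \<in> J" for j
    using assms(3)[OF that] E(1)[OF that] by (meson finite_SigmaI finite_subset)
  then have finI: "finite I" by (simp add: I_def assms(2))
  have nonneg0: "nonneg (\<lambda>j a b. 0)" by (simp add: nonneg_def)
  have "\<exists>\<alpha>. (\<exists>i\<in>I. \<alpha> i \<noteq> 0) \<and> (\<forall>x\<in>S. 0 \<le> (\<Sum>i\<in>I. \<alpha> i * x i))"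
  proof (rule convex_separate_0[OF finI])
    have "(\<lambda>i. case i of None \<Rightarrow> obj y0 - p + 1 | Some (j, a, b) \<Rightarrow> lin j y0 a b - 0) \<in> S"
      unfolding S_def using nonneg0 slater(1)
      by (intro CollectI exI[of _ y0] exI[of _ "\<lambda>j a b. 0"] exI[of _ "1::real"]) auto
    then show "S \<noteq> {}" by blast
  next
    fix x x' and u u' :: real
    assume x: "x \<in> S" "x' \<in> S" and u: "0 \<le> u" "0 \<le> u'" "u + u' = 1"
    obtain y Q s where 1: "y z = 1" "nonneg Q" "s > 0" "x None = obj y - p + s"
      "\<And>j a b. j \<in> J \<Longrightarrow> (a, b) \<in> E j \<Longrightarrow> x (Some (j, a, b)) = lin j y a b - Q j a b"
      using x(1) unfolding S_def by fast
    obtain y' Q' s' where 2: "y' z = 1" "nonneg Q'" "s' > 0" "x' None = obj y' - p + s'"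
      "\<And>j a b. j \<in> J \<Longrightarrow> (a, b) \<in> E j \<Longrightarrow> x' (Some (j, a, b)) = lin j y' a b - Q' j a b"
      using x(2) unfolding S_def by fast
    let ?y = "\<lambda>w. u * y w + u' * y' w" and ?Q = "\<lambda>j a b. u * Q j a b + u' * Q' j a b"
    have lin: "lin j ?y a b = u * lin j y a b + u' * lin j y' a b" for j a b
      unfolding lin_def sum_distrib_left sum.distrib[symmetric] by (simp add: algebra_simps)
    have obj: "obj ?y = u * obj y + u' * obj y'"
      unfolding obj_def sum_distrib_left sum.distrib[symmetric] by (simp add: algebra_simps)
    have "quad_form (V j) (?Q j) v = u * quad_form (V j) (Q j) v + u' * quad_form (V j) (Q' j) v" for j v
      unfolding sum_distrib_left sum.distrib[symmetric] by (simp add: algebra_simps)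
    with 1(2) 2(2) u have "nonneg ?Q" by (auto simp: nonneg_def)
    moreover have "0 < u * s + u' * s'"
    proof (cases "u = 0")
      case False
      with u 1(3) 2(3) show ?thesis by (intro add_pos_nonneg) auto
    qed (use u 2(3) in simp)
    moreover have "u * x None + u' * x' None = obj ?y - p + (u * s + u' * s')"
    proof -
      have "u * p + u' * p = p" using u(3) by (metis distrib_right mult_1)
      then show ?thesis unfolding obj 1(4) 2(4) by (simp add: algebra_simps)
    qed
    moreover have "u * x (Some (j, a, b)) + u' * x' (Some (j, a, b)) = lin j ?y a b - ?Q j a b"
      if "j \<in> J" "(a, b) \<in> E j" for j a b
      unfolding lin 1(5)[OF that] 2(5)[OF that] by (simp add: algebra_simps)
    ultimately show "(\<lambda>i. u * x i + u' * x' i) \<in> S"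
      unfolding S_def using 1(1) 2(1) u(3)
      by (intro CollectI exI[of _ ?y] exI[of _ ?Q] exI[of _ "u * s + u' * s'"]) auto
  next
    fix x
    assume "x \<in> S"
    then obtain y Q s where 1: "y z = 1" "nonneg Q" "s > 0" "x None = obj y - p + s"
      "\<And>j a b. j \<in> J \<Longrightarrow> (a, b) \<in> E j \<Longrightarrow> x (Some (j, a, b)) = lin j y a b - Q j a b"
      unfolding S_def by fast
    show "\<exists>i\<in>I. x i \<noteq> 0"
    proof (rule ccontr)
      assume "\<not> ?thesis"
      then have zero: "x None = 0" "\<And>j a b. j \<in> J \<Longrightarrow> (a, b) \<in> E j \<Longrightarrow> x (Some (j, a, b)) = 0"
        by (auto simp: I_def)
      \<comment> \<open>Vanishing residuals make \<open>Q\<close> a completion. Pattern and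
        coefficients are symmetric, so the symmetrized \<open>Q\<close> still agrees with
        \<open>lin\<close> on \<open>E j\<close> and \<open>bound\<close> applies, while the slack
        \<open>s > 0\<close> puts the objective below \<open>p\<close>.\<close>
      have "p \<le> obj y"
        unfolding obj_def
      proof (rule bound[of y, OF 1(1)])
        fix j assume j: "j \<in> J"
        have eq: "lin j y a b = Q j a b" if "(a, b) \<in> E j" for a b
          using 1(5)[OF j that] zero(2)[OF j that] by simp
        have sym: "lin j y a b = lin j y b a" for a b
          unfolding lin_def using c[OF j] by simp
        have "lin j y a b = (Q j a b + Q j b a) / 2" if "(a, b) \<in> E j" for a b
          using eq[OF that] eq[OF E(2)[OF j that]] sym[of a b] by simp
        moreover have "psd_on (V j) (\<lambda>a b. (Q j a b + Q j b a) / 2)"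
          using 1(2) j by (intro psd_on_symmetrization) (auto simp: nonneg_def)
        ultimately show "\<exists>Q. psd_on (V j) Q \<and> (\<forall>(a, b)\<in>E j. lin j y a b = Q a b)" by blast
      qed
      then show False using 1(3,4) zero(1) by simp
    qed
  qed
  then obtain \<alpha> where \<alpha>: "\<exists>i\<in>I. \<alpha> i \<noteq> 0" "\<And>x. x \<in> S \<Longrightarrow> 0 \<le> (\<Sum>i\<in>I. \<alpha> i * x i)"
    by blast
  define h where "h j a b = (if (a, b) \<in> E j then \<alpha> (Some (j, a, b)) else 0)" for j a b
  define l where "l = \<alpha> None"
  have ineq_s: "0 \<le> (\<Sum>j\<in>J. mat_inner (V j) (h j) (lin j y)) - (\<Sum>j\<in>J. mat_inner (V j) (h j) (Q j))
      + l * (obj y - p) + s * l" if "y z = 1" "nonneg Q" "s > 0" for y Q s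
  proof -
    define x where "x = (\<lambda>i. case i of None \<Rightarrow> obj y - p + s | Some (j, a, b) \<Rightarrow> lin j y a b - Q j a b)"
    have "x \<in> S"
      unfolding S_def x_def using that
      by (intro CollectI exI[of _ y] exI[of _ Q] exI[of _ s]) auto
    have "(\<Sum>i\<in>I. \<alpha> i * x i) = l * x None + (\<Sum>i\<in>Sigma J E. \<alpha> (Some i) * x (Some i))"
      unfolding I_def by (subst sum.insert)
        (use finE assms(2) in \<open>auto simp: l_def sum.reindex comp_def\<close>)
    also have "(\<Sum>i\<in>Sigma J E. \<alpha> (Some i) * x (Some i))
        = (\<Sum>j\<in>J. \<Sum>ab\<in>E j. \<alpha> (Some (j, ab)) * x (Some (j, ab)))"
      by (subst sum.Sigma) (use finE assms(2) in auto)
    also have "\<dots> = (\<Sum>j\<in>J. mat_inner (V j) (h j) (\<lambda>a b. lin j y a b - Q j a b))"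
    proof (rule sum.cong[OF refl])
      fix j assume j: "j \<in> J"
      have "(\<Sum>ab\<in>E j. \<alpha> (Some (j, ab)) * x (Some (j, ab)))
          = (\<Sum>(a, b)\<in>V j \<times> V j. h j a b * (lin j y a b - Q j a b))"
        by (rule sum.mono_neutral_cong_left) (use j E(1) assms(3) in \<open>auto simp: h_def x_def\<close>)
      then show "(\<Sum>ab\<in>E j. \<alpha> (Some (j, ab)) * x (Some (j, ab)))
          = mat_inner (V j) (h j) (\<lambda>a b. lin j y a b - Q j a b)"
        by (simp add: sum.cartesian_product)
    qed
    also have "\<dots> = (\<Sum>j\<in>J. mat_inner (V j) (h j) (lin j y)) - (\<Sum>j\<in>J. mat_inner (V j) (h j) (Q j))"
      by (simp add: right_diff_distrib sum_subtractf)
    finally show ?thesis using \<alpha>(2)[OF \<open>x \<in> S\<close>] by (simp add: x_def algebra_simps)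
  qed
  \<comment> \<open>The slack is an arbitrary positive number: letting it tend to 0 removes its
    term, letting it grow forces \<open>l\<close> to be nonnegative.\<close>
  have ineq: "0 \<le> (\<Sum>j\<in>J. mat_inner (V j) (h j) (lin j y)) - (\<Sum>j\<in>J. mat_inner (V j) (h j) (Q j))
      + l * (obj y - p)" if "y z = 1" "nonneg Q" for y Q
    using ineq_s[of y Q, OF that] by (rule linear_nonneg_imp_const_nonneg)
  have "0 \<le> l"
    using ineq_s[of y0 "\<lambda>j a b. 0", OF slater(1) nonneg0] by (rule linear_nonneg_imp_slope_nonneg)
  \<comment> \<open>Only block \<open>i\<close> is switched on, scaled by \<open>t\<close>; for
    large \<open>t\<close> its term dominates the inequality.\<close>
  have polar: "mat_inner (V i) (h i) P \<le> 0" if i: "i \<in> J" and P: "\<And>v. 0 \<le> quad_form (V i) P v" for i P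
  proof -
    have "0 \<le> ((\<Sum>j\<in>J. mat_inner (V j) (h j) (lin j y0)) + l * (obj y0 - p)) + t * (- mat_inner (V i) (h i) P)"
      if "t > 0" for t
    proof -
      define Q where "Q j a b = (if j = i then t * P a b else 0)" for j a b
      have "quad_form (V j) (Q j) v = (if j = i then t * quad_form (V i) P v else 0)" for j v
        by (simp add: Q_def sum_distrib_left mult_ac)
      then have "nonneg Q"
        unfolding nonneg_def using P \<open>t > 0\<close> by simp
      moreover have "(\<Sum>j\<in>J. mat_inner (V j) (h j) (Q j)) = t * mat_inner (V i) (h i) P"
      proof -
        have "mat_inner (V j) (h j) (Q j) = (if j = i then t * mat_inner (V i) (h i) P else 0)" for j
          by (simp add: Q_def sum_distrib_left mult_ac)
        then show ?thesis using i assms(2) by simp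
      qed
      ultimately show ?thesis using ineq[of y0 Q, OF slater(1)] by simp
    qed
    then have "0 \<le> - mat_inner (V i) (h i) P" by (rule linear_nonneg_imp_slope_nonneg)
    then show ?thesis by simp
  qed
  \<comment> \<open>A skew-symmetric test matrix has zero quadratic form and is therefore admissible
    in \<open>polar\<close>. The one supported on the positions of \<open>a\<close> and
    \<open>b\<close> gives one inequality, the exchange of \<open>a\<close> and \<open>b\<close> the
    other.\<close>
  have h_sym: "h j a b = h j b a" if j: "j \<in> J" and ab: "a \<in> V j" "b \<in> V j" for j a b
  proof -
    have le: "h j a b \<le> h j b a" if ab: "a \<in> V j" "b \<in> V j" for a b
    proof -
      let ?P = "\<lambda>a' b'. (if a' = a then if b' = b then 1 else 0 else 0)
                       - (if a' = b then if b' = a then 1 else 0 else 0::real)"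
      have unit: "(\<Sum>a'\<in>V j. \<Sum>b'\<in>V j. M a' b' * (if a' = d then if b' = e then 1 else 0 else 0)) = M d e"
        if "d \<in> V j" "e \<in> V j" for M :: "'v mfun" and d e
      proof -
        have "(\<Sum>b'\<in>V j. M a' b' * (if a' = d then if b' = e then 1 else 0 else 0))
            = (if a' = d then M d e else 0)" for a'
          using that assms(3)[OF j]
          by (cases "a' = d") (simp_all add: if_distrib[of "\<lambda>t. _ * t"] cong: if_cong)
        then show ?thesis using that assms(3)[OF j] by simp
      qed
      have P: "mat_inner (V j) M ?P = M a b - M b a" for M
        unfolding right_diff_distrib sum_subtractf by (simp only: unit ab)
      have "quad_form (V j) ?P v = mat_inner (V j) (\<lambda>a b. v a * v b) ?P" for v
        by (simp only: mult_ac)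
      then have "mat_inner (V j) (h j) ?P \<le> 0" by (intro polar[OF j]) (simp only: P, simp)
      moreover note P[of "h j"]
      ultimately show ?thesis by simp
    qed
    show ?thesis using le[OF ab] le[OF ab(2,1)] by simp
  qed
  have psd: "psd_on (V j) (\<lambda>a b. - h j a b)" if j: "j \<in> J" for j
    unfolding psd_on_def
  proof (intro conjI ballI allI)
    fix v
    have "mat_inner (V j) (h j) (\<lambda>a b. v a * v b) \<le> 0"
      by (intro polar[OF j] psd_on_quad_form_nonneg psd_on_outer)
    then show "0 \<le> quad_form (V j) (\<lambda>a b. - h j a b) v"
      by (simp add: sum_negf mult_ac)
  qed (use h_sym[OF j] in simp)
  \<comment> \<open>Otherwise the inequality at \<open>y0\<close> with \<open>Q = 0\<close> bounds
    the sum of the pairings of \<open>Q0 j\<close> with \<open>- h j\<close> above by 0, although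
    some \<open>h i\<close> is nonzero. \<open>lin j y0\<close> may be replaced by
    \<open>Q0 j\<close> because \<open>h j\<close> is supported on \<open>E j\<close>.\<close>
  have "l \<noteq> 0"
  proof
    assume "l = 0"
    with \<alpha>(1) obtain i a b where i: "i \<in> J" "(a, b) \<in> E i" "h i a b \<noteq> 0"
      by (auto simp: I_def l_def h_def)
    have "mat_inner (V j) (h j) (lin j y0) = - mat_inner (V j) (Q0 j) (\<lambda>a b. - h j a b)" if "j \<in> J" for j
      unfolding sum_negf[symmetric]
      by (intro sum.cong refl) (auto simp: h_def slater(3)[OF that])
    then have le: "0 \<le> (\<Sum>j\<in>J. - mat_inner (V j) (Q0 j) (\<lambda>a b. - h j a b))"
      using ineq[of y0 "\<lambda>j a b. 0", OF slater(1) nonneg0] \<open>l = 0\<close> by simp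
    have pos: "0 < mat_inner (V j) (Q0 j) (\<lambda>a b. - h j a b)"
      if j: "j \<in> J" and "a \<in> V j" "b \<in> V j" "- h j a b \<noteq> 0" for j a b
      by (rule pos_def_sum_prod_pos[where R = "\<lambda>a b. - h j a b",
            OF assms(3)[OF j] slater(2)[OF j] psd[OF j] that(2-4)])
    have "0 \<le> mat_inner (V j) (Q0 j) (\<lambda>a b. - h j a b)" if j: "j \<in> J" for j
    proof (cases "\<exists>a\<in>V j. \<exists>b\<in>V j. - h j a b \<noteq> 0")
      case True
      then show ?thesis using pos[OF j] by (blast intro: less_imp_le)
    qed simp
    moreover have "0 < mat_inner (V i) (Q0 i) (\<lambda>a b. - h i a b)"
    proof (rule pos[OF i(1)])
      show "a \<in> V i" "b \<in> V i" using i(2) E(1)[OF i(1)] by blast+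
      show "- h i a b \<noteq> 0" using i(3) by simp
    qed
    ultimately have "0 < (\<Sum>j\<in>J. mat_inner (V j) (Q0 j) (\<lambda>a b. - h j a b))"
      using i(1) by (intro sum_pos2[OF assms(2) i(1)]) simp_all
    with le show False by (simp add: sum_negf)
  qed
  with \<open>0 \<le> l\<close> have "l > 0" by simp
  define H where "H j a b = - h j a b / l" for j a b
  define K where "K w = (\<Sum>j\<in>J. \<Sum>a\<in>V j. \<Sum>b\<in>V j. c j a b w * H j b a)" for w
  have K: "p \<le> (\<Sum>w\<in>W. (f w - K w) * y w)" if "y z = 1" for y
  proof -
    have "mat_inner (V j) (h j) (lin j y)
        = - l * (\<Sum>w\<in>W. (\<Sum>a\<in>V j. \<Sum>b\<in>V j. c j a b w * H j b a) * y w)" if j: "j \<in> J" for j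
    proof -
      have "mat_inner (V j) (h j) (lin j y) = (\<Sum>a\<in>V j. \<Sum>b\<in>V j. \<Sum>w\<in>W. - l * (c j a b w * H j b a * y w))"
        unfolding lin_def sum_distrib_left
        by (intro sum.cong refl) (use \<open>l > 0\<close> h_sym[OF j] in \<open>auto simp: H_def\<close>)
      also have "\<dots> = (\<Sum>a\<in>V j. \<Sum>w\<in>W. \<Sum>b\<in>V j. - l * (c j a b w * H j b a * y w))"
        by (intro sum.cong refl sum.swap)
      also have "\<dots> = (\<Sum>w\<in>W. \<Sum>a\<in>V j. \<Sum>b\<in>V j. - l * (c j a b w * H j b a * y w))"
        by (rule sum.swap)
      finally show ?thesis by (simp add: sum_distrib_left sum_distrib_right)
    qed
    then have "(\<Sum>j\<in>J. mat_inner (V j) (h j) (lin j y))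
        = - l * (\<Sum>j\<in>J. \<Sum>w\<in>W. (\<Sum>a\<in>V j. \<Sum>b\<in>V j. c j a b w * H j b a) * y w)"
      by (simp add: sum_distrib_left)
    also have "\<dots> = - l * (\<Sum>w\<in>W. K w * y w)"
      by (subst sum.swap) (simp add: K_def sum_distrib_right)
    finally have "0 \<le> l * (obj y - p - (\<Sum>w\<in>W. K w * y w))"
      using ineq[of y "\<lambda>j a b. 0", OF that nonneg0] by (simp add: algebra_simps)
    then have "0 \<le> obj y - p - (\<Sum>w\<in>W. K w * y w)"
      using \<open>l > 0\<close> by (simp add: zero_le_mult_iff)
    then show ?thesis by (simp add: obj_def left_diff_distrib sum_subtractf)
  qed
  \<comment> \<open>Test vectors with 1 at \<open>z\<close> and \<open>t\<close> at a single
    \<open>w\<close>: boundedness below in \<open>t\<close> forces the dual equation at every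
    \<open>w\<close> other than \<open>z\<close>, and what remains at \<open>z\<close> is the dual
    value.\<close>
  have eval: "(\<Sum>u\<in>W. (f u - K u) * (if u = z then 1 else if u = w then t else 0))
      = (f z - K z) + t * (if w = z then 0 else f w - K w)" if "w \<in> W" for w t
  proof -
    have "(\<Sum>u\<in>W. (f u - K u) * (if u = z then 1 else if u = w then t else 0))
        = (\<Sum>u\<in>W. (if u = z then f u - K u else 0) + (if u = w then if w = z then 0 else t * (f u - K u) else 0))"
      by (intro sum.cong) auto
    then show ?thesis using that assms(4,5) by (simp add: sum.distrib)
  qed
  have eval': "0 \<le> (f z - K z - p) + t * (if w = z then 0 else f w - K w)" if "w \<in> W" for w t
    using K[of "\<lambda>u. if u = z then 1 else if u = w then t else 0"] unfolding eval[OF that] by simp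
  have "(if w = z then 0 else f w - K w) = 0" if "w \<in> W" for w
    using eval'[OF that] by (rule affine_nonneg_imp_slope_0)
  then have "K w = f w - (if w = z then f z - K z else 0)" if "w \<in> W" for w
    using that by fastforce
  moreover have "p \<le> f z - K z" using eval'[OF assms(5), of 0] by simp
  moreover have "psd_on (V j) (H j)" if j: "j \<in> J" for j
    unfolding psd_on_def
  proof (intro conjI ballI allI)
    fix v
    have "quad_form (V j) (H j) v = quad_form (V j) (\<lambda>a b. - h j a b) v / l"
      by (simp add: H_def sum_divide_distrib)
    then show "0 \<le> quad_form (V j) (H j) v"
      using psd_on_quad_form_nonneg[OF psd[OF j], of v] \<open>l > 0\<close> by simp
  qed (use h_sym[OF j] in \<open>simp add: H_def\<close>)
  moreover have "H j a b = 0" if "(a, b) \<notin> E j" for j a b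
    using that by (simp add: H_def h_def)
  ultimately show ?thesis unfolding K_def by (intro exI[of _ H] exI[of _ "f z - K z"]) (auto simp: K_def)
qed

section \<open>Moments and localizing matrices\<close>

definition monomial_at :: "('n::finite) expo \<Rightarrow> real ^ 'n \<Rightarrow> real" where
  "monomial_at \<alpha> x = (\<Prod>i\<in>UNIV. x $ i ^ \<alpha> i)"

lemma monomial_at_addexp: "monomial_at (addexp a b) x = monomial_at a x * monomial_at b x"
  by (simp add: monomial_at_def addexp_def power_add prod.distrib)

lemma peval_monomial_at: "peval p x = (\<Sum>\<alpha>\<in>psupp p. p \<alpha> * monomial_at \<alpha> x)"
  by (simp add: peval_def monomial_at_def)

lemma continuous_on_peval [continuous_intros]: "continuous_on S (peval p)"
  unfolding peval_def by (intro continuous_intros)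

lemma le_tdeg: "\<alpha> i \<le> tdeg \<alpha>"
  unfolding tdeg_def by (rule member_le_sum) auto

lemma finite_Nk: "finite (Nk k)"
proof (rule finite_subset)
  show "Nk k \<subseteq> PiE UNIV (\<lambda>_. {..k})"
    using le_tdeg by (auto simp: Nk_def PiE_UNIV_domain intro: order_trans)
qed (auto intro: finite_PiE)

section \<open>Shifts by monomials and the entries of localizing matrices\<close>

lemma psupp_xmon: "psupp (xmon e) = {e}"
  by (auto simp: psupp_def xmon_def)

lemma addexp_cancel: "addexp a e = addexp b e \<longleftrightarrow> a = b"
  by (auto simp: addexp_def fun_eq_iff)

lemma addexp_commute: "addexp a b = addexp b a"
  by (auto simp: addexp_def)

lemma addexp_assoc: "addexp (addexp a b) c = addexp a (addexp b c)"
  by (simp add: addexp_def add.assoc)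

lemma addexp_zexp: "addexp zexp a = a" "addexp a zexp = a"
  by (simp_all add: addexp_def zexp_def)

lemma pmult_xmon_addexp: "pmult p (xmon e) (addexp a e) = p a"
proof -
  have "{(c, b). c \<in> psupp p \<and> b \<in> psupp (xmon e) \<and> addexp c b = addexp a e} =
      (if p a = 0 then {} else {(a, e)})"
    unfolding psupp_xmon by (auto simp: addexp_cancel psupp_def)
  then show ?thesis by (simp add: pmult_def xmon_def)
qed

lemma psupp_pmult_xmon: "psupp (pmult p (xmon e)) = (\<lambda>a. addexp a e) ` psupp p"
proof -
  have "\<alpha> \<in> (\<lambda>a. addexp a e) ` psupp p" if "pmult p (xmon e) \<alpha> \<noteq> 0" for \<alpha>
  proof -
    have "{(c, b). c \<in> psupp p \<and> b \<in> psupp (xmon e) \<and> addexp c b = \<alpha>} \<noteq> {}"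
    proof
      assume "{(c, b). c \<in> psupp p \<and> b \<in> psupp (xmon e) \<and> addexp c b = \<alpha>} = {}"
      with that show False unfolding pmult_def by (simp only: sum.empty)
    qed
    then show ?thesis by (auto simp: psupp_xmon)
  qed
  then show ?thesis by (auto simp: psupp_def pmult_xmon_addexp)
qed

lemma locmat_eq: "locmat g j y a b = (\<Sum>\<delta>\<in>psupp (gg g j). gg g j \<delta> * y (addexp (addexp a b) \<delta>))"
proof -
  have "inj_on (\<lambda>\<delta>. addexp \<delta> (addexp a b)) (psupp (gg g j))"
    by (auto simp: inj_on_def addexp_cancel)
  then show ?thesis
    by (simp add: locmat_def Lfun_def psupp_pmult_xmon sum.reindex pmult_xmon_addexp addexp_commute)
qed

text \<open>Sorting the terms by their total exponent exhibits the matrices \<open>Cmat\<close> as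
  the coefficients of the localizing matrix, viewed as a linear function of
  \<open>y\<close>.\<close>

lemma locmat_eq_Cmat:
  assumes "finite (psupp (gg g j))" "finite W" "msumset (psupp (gg g j)) {addexp a b} \<subseteq> W"
  shows "locmat g j y a b = (\<Sum>w\<in>W. Cmat g j w a b * y w)"
proof -
  have "(\<lambda>\<delta>. addexp (addexp a b) \<delta>) ` psupp (gg g j) \<subseteq> W"
    using assms(3) by (auto simp: msumset_def addexp_commute)
  then have "(\<Sum>w\<in>W. \<Sum>\<delta>\<in>{\<delta>\<in>psupp (gg g j). addexp (addexp a b) \<delta> = w}.
      gg g j \<delta> * y (addexp (addexp a b) \<delta>)) = locmat g j y a b"
    unfolding locmat_eq by (rule sum.group[OF assms(1,2)])
  moreover have "(\<Sum>\<delta>\<in>{\<delta>\<in>psupp (gg g j). addexp (addexp a b) \<delta> = w}.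
      gg g j \<delta> * y (addexp (addexp a b) \<delta>)) = Cmat g j w a b * y w" for w
    unfolding Cmat_def sum_distrib_right by (rule sum.cong) auto
  ultimately show ?thesis by simp
qed

text \<open>Induction on the variables. With the other coordinates fixed, the sum is a univariate
  polynomial in the new one with more roots than its degree allows, so its coefficients vanish;
  these are polynomials in the remaining variables. Exponents are total functions, hence the
  requirement that those in \<open>A\<close> be determined by their values on
  \<open>J\<close>.\<close>

lemma coefficients_zero_if_vanishing_on_grid:
  fixes p :: "('i \<Rightarrow> nat) \<Rightarrow> real" and T :: "'i \<Rightarrow> real set"
  assumes "finite J" "finite A"
    and "\<And>\<alpha> \<beta>. \<alpha> \<in> A \<Longrightarrow> \<beta> \<in> A \<Longrightarrow> (\<forall>i\<in>J. \<alpha> i = \<beta> i) \<Longrightarrow> \<alpha> = \<beta>"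
    and "\<And>\<alpha> i. \<alpha> \<in> A \<Longrightarrow> i \<in> J \<Longrightarrow> \<alpha> i < card (T i)"
    and "\<And>x. (\<forall>i\<in>J. x i \<in> T i) \<Longrightarrow> (\<Sum>\<alpha>\<in>A. p \<alpha> * (\<Prod>i\<in>J. x i ^ \<alpha> i)) = 0"
    and "\<alpha> \<in> A"
  shows "p \<alpha> = 0"
  using assms
proof (induction J arbitrary: A \<alpha> rule: finite_induct)
  case empty
  \<comment> \<open>Without variables all exponents in \<open>A\<close> coincide, and the sum is the
    single coefficient, whatever the argument.\<close>
  then have "A = {\<alpha>}" by blast
  then show ?case using empty.prems(4)[of undefined] by simp
next
  case (insert k J)
  define A' where "A' d = {\<beta> \<in> A. \<beta> k = d}" for d
  have sub: "A' d \<subseteq> A" for d by (auto simp: A'_def)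
  have fin: "finite (A' d)" for d using finite_subset[OF sub insert.prems(1)] .
  show ?case
  proof (rule insert.IH[of "A' (\<alpha> k)"])
    fix x assume x: "\<forall>i\<in>J. x i \<in> T i"
    define q where "q d = (\<Sum>\<beta>\<in>A' d. p \<beta> * (\<Prod>i\<in>J. x i ^ \<beta> i))" for d
    define n where "n = card (T k) - 1"
    have A: "\<beta> k \<le> n" if "\<beta> \<in> A" for \<beta>
      using insert.prems(3)[OF that, of k] by (simp add: n_def)
    have "T k \<subseteq> {t. (\<Sum>d\<le>n. q d * t ^ d) = 0}"
    proof
      fix t assume t: "t \<in> T k"
      define x' where "x' = x(k := t)"
      have x': "(\<Prod>i\<in>J. x' i ^ \<beta> i) = (\<Prod>i\<in>J. x i ^ \<beta> i)" for \<beta>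
        using insert.hyps by (intro prod.cong) (auto simp: x'_def)
      have "(\<Sum>\<beta>\<in>A' d. p \<beta> * (\<Prod>i\<in>insert k J. x' i ^ \<beta> i)) = q d * t ^ d" for d
        using insert.hyps unfolding q_def sum_distrib_right
        by (intro sum.cong refl) (simp_all add: x' A'_def, simp add: x'_def)
      then have "(\<Sum>d\<le>n. q d * t ^ d) = (\<Sum>d\<le>n. \<Sum>\<beta>\<in>{\<beta> \<in> A. \<beta> k = d}. p \<beta> * (\<Prod>i\<in>insert k J. x' i ^ \<beta> i))"
        by (simp add: A'_def)
      also have "\<dots> = (\<Sum>\<beta>\<in>A. p \<beta> * (\<Prod>i\<in>insert k J. x' i ^ \<beta> i))"
        by (rule sum.group) (use A insert.prems in auto)
      also have "\<dots> = 0"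
        by (rule insert.prems(4)) (use x t in \<open>auto simp: x'_def\<close>)
      finally show "t \<in> {t. (\<Sum>d\<le>n. q d * t ^ d) = 0}" by simp
    qed
    moreover have "n < card (T k)"
      using insert.prems(3)[OF insert.prems(5), of k] by (simp add: n_def)
    ultimately have "q (\<alpha> k) = 0"
      using Transcendental.polyfun_rootbound[where c = q and k = "\<alpha> k" and n = n, OF _ A[OF insert.prems(5)]]
      by (meson card_mono leD order_le_less_trans)
    then show "(\<Sum>\<beta>\<in>A' (\<alpha> k). p \<beta> * (\<Prod>i\<in>J. x i ^ \<beta> i)) = 0" by (simp add: q_def)
  next
    show "\<beta> = \<gamma>" if "\<beta> \<in> A' (\<alpha> k)" "\<gamma> \<in> A' (\<alpha> k)" "\<forall>i\<in>J. \<beta> i = \<gamma> i" for \<beta> \<gamma>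
      using that insert.prems(2)[of \<beta> \<gamma>] by (auto simp: A'_def)
  qed (use insert.prems fin sub in \<open>auto simp: A'_def\<close>)
qed

lemma open_contains_grid:
  fixes S :: "(real ^ 'n::finite) set"
  assumes "open S" "S \<noteq> {}"
  shows "\<exists>T. (\<forall>i. finite (T i) \<and> card (T i) = K) \<and> {x. \<forall>i. x $ i \<in> T i} \<subseteq> S"
proof -
  obtain c e where c: "ball c e \<subseteq> S" "e > 0"
    using assms by (meson ex_in_conv open_contains_ball)
  \<comment> \<open>The Euclidean norm is at most the sum of the absolute coordinates, so this side
    length keeps the open cube with corner \<open>c\<close> inside the ball.\<close>
  define d where "d = e / real CARD('n)"
  have "d > 0" using c(2) by (simp add: d_def)
  have "\<exists>T. T \<subseteq> {c $ i<..<c $ i + d} \<and> finite T \<and> card T = K" for i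
    using infinite_arbitrarily_large[of "{c $ i<..<c $ i + d}" K] \<open>d > 0\<close> by auto
  then obtain T where T: "\<And>i. T i \<subseteq> {c $ i<..<c $ i + d}" "\<And>i. finite (T i)" "\<And>i. card (T i) = K"
    by metis
  have "x \<in> S" if x: "\<And>i. x $ i \<in> T i" for x
  proof -
    have "norm (x - c) \<le> (\<Sum>i\<in>UNIV. \<bar>(x - c) $ i\<bar>)" by (rule norm_le_l1_cart)
    also have "\<dots> < (\<Sum>i\<in>(UNIV::'n set). d)"
    proof (rule sum_strict_mono)
      show "\<bar>(x - c) $ i\<bar> < d" for i
        using subsetD[OF T(1) x, of i] by simp
    qed auto
    also have "\<dots> = e" by (simp add: d_def)
    finally show ?thesis using c(1) by (auto simp: dist_norm norm_minus_commute)
  qed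
  with T show ?thesis by blast
qed

lemma finite_grid:
  assumes "\<And>i. finite (T i)"
  shows "finite {x :: real ^ 'n::finite. \<forall>i. x $ i \<in> T i}"
proof -
  have "{x. \<forall>i. x $ i \<in> T i} = vec_lambda ` PiE UNIV T"
    by (force simp: PiE_UNIV_domain image_iff intro: exI[of _ "vec_nth _"])
  then show ?thesis using assms by (simp add: finite_PiE)
qed

lemma polynomial_vanishing_on_grid:
  fixes p :: "('n::finite) rpoly"
  assumes "finite A" "\<And>\<alpha> i. \<alpha> \<in> A \<Longrightarrow> \<alpha> i < card (T i)"
    and "\<And>x. (\<And>i. x $ i \<in> T i) \<Longrightarrow> (\<Sum>\<alpha>\<in>A. p \<alpha> * monomial_at \<alpha> x) = 0"
    and "\<alpha> \<in> A"
  shows "p \<alpha> = 0"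
proof (rule coefficients_zero_if_vanishing_on_grid[where J = UNIV and T = T])
  show "(\<Sum>\<alpha>\<in>A. p \<alpha> * (\<Prod>i\<in>UNIV. x i ^ \<alpha> i)) = 0" if "\<forall>i\<in>UNIV. x i \<in> T i" for x
    using assms(3)[of "vec_lambda x"] that by (simp add: monomial_at_def)
qed (use assms in auto)

text \<open>If the polynomial vanished on all of \<open>S\<close>, it would vanish on a grid with
  more points per direction than its degree, and all its coefficients would be zero.\<close>

lemma peval_nonzero_on_open_subset:
  fixes S :: "(real ^ 'n::finite) set"
  assumes "open S" "S \<noteq> {}" "finite (psupp p)" "psupp p \<noteq> {}"
  shows "open {x \<in> S. peval p x \<noteq> 0}" "{x \<in> S. peval p x \<noteq> 0} \<noteq> {}"
proof -
  have "open (S \<inter> peval p -` (- {0}))"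
    by (rule continuous_open_preimage[OF continuous_on_peval assms(1)]) auto
  moreover have "{x \<in> S. peval p x \<noteq> 0} = S \<inter> peval p -` (- {0})" by auto
  ultimately show "open {x \<in> S. peval p x \<noteq> 0}" by simp
  show "{x \<in> S. peval p x \<noteq> 0} \<noteq> {}"
  proof
    assume zero: "{x \<in> S. peval p x \<noteq> 0} = {}"
    define K where "K = Suc (Max (tdeg ` psupp p))"
    obtain T where T: "\<And>i. card (T i) = K" "{x. \<forall>i. x $ i \<in> T i} \<subseteq> S"
      using open_contains_grid[OF assms(1,2), of K] by blast
    have deg: "\<alpha> i < card (T i)" if "\<alpha> \<in> psupp p" for \<alpha> i
    proof -
      have "tdeg \<alpha> \<le> Max (tdeg ` psupp p)" using that assms(3) by simp
      then show ?thesis using le_tdeg[of \<alpha> i] by (simp add: T K_def)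
    qed
    have "p \<alpha> = 0" if "\<alpha> \<in> psupp p" for \<alpha>
    proof (rule polynomial_vanishing_on_grid[where A = "psupp p" and p = p and T = T])
      show "(\<Sum>\<alpha>\<in>psupp p. p \<alpha> * monomial_at \<alpha> x) = 0" if "\<And>i. x $ i \<in> T i" for x
        using that T(2) zero by (auto simp: peval_monomial_at)
    qed (use assms(3) deg that in auto)
    then show False using assms(4) by (auto simp: psupp_def)
  qed
qed

lemma common_peval_nonzero_on_open_subset:
  fixes S :: "(real ^ 'n::finite) set"
  assumes "finite J" "open S" "S \<noteq> {}" "\<And>j. j \<in> J \<Longrightarrow> finite (psupp (g j)) \<and> psupp (g j) \<noteq> {}"
  shows "\<exists>U\<subseteq>S. open U \<and> U \<noteq> {} \<and> (\<forall>x\<in>U. \<forall>j\<in>J. peval (g j) x \<noteq> 0)"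
  using assms(1,4)
proof (induction J rule: finite_induct)
  case empty
  then show ?case using assms by auto
next
  case (insert k J)
  then obtain U where U: "U \<subseteq> S" "open U" "U \<noteq> {}" "\<forall>x\<in>U. \<forall>j\<in>J. peval (g j) x \<noteq> 0"
    by auto
  then show ?case
    using peval_nonzero_on_open_subset[of U "g k"] insert.prems
    by (intro exI[of _ "{x \<in> U. peval (g k) x \<noteq> 0}"]) auto
qed

lemma peval_one_poly: "peval one_poly x = 1"
  by (simp add: peval_monomial_at one_poly_def psupp_xmon) (simp add: xmon_def monomial_at_def zexp_def)

text \<open>The moments of the uniform measure on a sufficiently fine grid inside the interior, placed
  where no nonzero constraint polynomial vanishes.\<close>

lemma exists_strictly_feasible_moments:
  fixes g :: "nat \<Rightarrow> ('n::finite) rpoly"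
  assumes "\<forall>j\<in>{1..m}. finite (psupp (g j))" "interior (semialg_set g m) \<noteq> {}"
  shows "\<exists>y. y zexp = 1 \<and> (\<forall>j\<in>{0..m}. psupp (gg g j) \<noteq> {} \<longrightarrow>
    (\<forall>v. (\<exists>a\<in>Bset g r j. v a \<noteq> 0) \<longrightarrow> 0 < quad_form (Bset g r j) (locmat g j y) v))"
proof -
  define J where "J = {j \<in> {1..m}. psupp (g j) \<noteq> {}}"
  have "\<exists>U\<subseteq>interior (semialg_set g m). open U \<and> U \<noteq> {} \<and> (\<forall>x\<in>U. \<forall>j\<in>J. peval (g j) x \<noteq> 0)"
    by (rule common_peval_nonzero_on_open_subset) (use assms in \<open>simp_all add: J_def\<close>)
  then obtain U where U: "U \<subseteq> interior (semialg_set g m)" "open U" "U \<noteq> {}"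
    "\<And>x j. x \<in> U \<Longrightarrow> j \<in> J \<Longrightarrow> peval (g j) x \<noteq> 0"
    by blast
  have pos: "0 < peval (gg g j) x" if "x \<in> U" "j \<in> {0..m}" "psupp (gg g j) \<noteq> {}" for x j
  proof (cases "j = 0")
    case False
    then have "peval (g j) x \<noteq> 0" using U(4)[OF that(1), of j] that by (auto simp: J_def gg_def)
    moreover have "x \<in> semialg_set g m" using U(1) that(1) interior_subset by blast
    then have "0 \<le> peval (g j) x" using False that(2) by (simp add: semialg_set_def)
    ultimately show ?thesis using False by (simp add: gg_def)
  qed (simp add: gg_def peval_one_poly)
  \<comment> \<open>Basis exponents have entries at most \<open>r\<close>, so \<open>r + 1\<close>
    points per coordinate suffice to make a polynomial with such exponents zero once it vanishes on
    the grid.\<close>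
  obtain T where T: "\<And>i. finite (T i)" "\<And>i. card (T i) = Suc r" "{x. \<forall>i. x $ i \<in> T i} \<subseteq> U"
    using open_contains_grid[OF U(2,3), of "Suc r"] by blast
  define X where "X = {x :: real ^ 'n. \<forall>i. x $ i \<in> T i}"
  have "finite X" unfolding X_def by (rule finite_grid[OF T(1)])
  have "X \<noteq> {}"
  proof -
    have "T i \<noteq> {}" for i using T(2)[of i] by auto
    then have "(\<chi> i. SOME t. t \<in> T i) \<in> X" by (simp add: X_def some_in_eq)
    then show ?thesis by blast
  qed
  define N where "N = real (card X)"
  have "N > 0" using \<open>finite X\<close> \<open>X \<noteq> {}\<close> by (simp add: N_def card_gt_0_iff)
  define y where "y \<alpha> = (\<Sum>x\<in>X. monomial_at \<alpha> x) / N" for \<alpha>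
  \<comment> \<open>The form is the average over the grid of the constraint times the square of the
    polynomial with coefficients \<open>v\<close>.\<close>
  have form: "quad_form (Bset g r j) (locmat g j y) v =
      (\<Sum>x\<in>X. peval (gg g j) x * (\<Sum>a\<in>Bset g r j. v a * monomial_at a x)\<^sup>2) / N" for j v
  proof -
    have loc: "locmat g j y a b = (\<Sum>x\<in>X. peval (gg g j) x * monomial_at a x * monomial_at b x) / N" for a b
    proof -
      have "locmat g j y a b = (\<Sum>\<delta>\<in>psupp (gg g j). \<Sum>x\<in>X.
          gg g j \<delta> * monomial_at \<delta> x * monomial_at a x * monomial_at b x / N)"
        by (simp add: locmat_eq y_def monomial_at_addexp sum_distrib_left sum_divide_distrib mult_ac)
      also have "\<dots> = (\<Sum>x\<in>X. \<Sum>\<delta>\<in>psupp (gg g j).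
          gg g j \<delta> * monomial_at \<delta> x * monomial_at a x * monomial_at b x / N)"
        by (rule sum.swap)
      finally show ?thesis
        by (simp add: peval_monomial_at sum_distrib_right sum_divide_distrib)
    qed
    have "quad_form (Bset g r j) (locmat g j y) v = (\<Sum>a\<in>Bset g r j. \<Sum>b\<in>Bset g r j. \<Sum>x\<in>X.
        peval (gg g j) x * ((v a * monomial_at a x) * (v b * monomial_at b x)) / N)"
      by (simp add: loc sum_distrib_left sum_distrib_right sum_divide_distrib mult_ac)
    also have "\<dots> = (\<Sum>a\<in>Bset g r j. \<Sum>x\<in>X. \<Sum>b\<in>Bset g r j.
        peval (gg g j) x * ((v a * monomial_at a x) * (v b * monomial_at b x)) / N)"
      by (intro sum.cong refl sum.swap)
    also have "\<dots> = (\<Sum>x\<in>X. \<Sum>a\<in>Bset g r j. \<Sum>b\<in>Bset g r j.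
        peval (gg g j) x * ((v a * monomial_at a x) * (v b * monomial_at b x)) / N)"
      by (rule sum.swap)
    finally show ?thesis
      unfolding power2_eq_square sum_product by (simp add: sum_distrib_left sum_divide_distrib)
  qed
  show ?thesis
  proof (intro exI[of _ y] conjI ballI impI allI)
    show "y zexp = 1" using \<open>N > 0\<close> by (simp add: y_def monomial_at_def zexp_def N_def)
    fix j and v :: "'n expo \<Rightarrow> real"
    assume j: "j \<in> {0..m}" "psupp (gg g j) \<noteq> {}" and v: "\<exists>a\<in>Bset g r j. v a \<noteq> 0"
    have "\<exists>x\<in>X. (\<Sum>a\<in>Bset g r j. v a * monomial_at a x) \<noteq> 0"
    proof (rule ccontr)
      assume zero: "\<not> ?thesis"
      have "v a = 0" if "a \<in> Bset g r j" for a
      proof (rule polynomial_vanishing_on_grid[where T = T, OF _ _ _ that])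
        show "finite (Bset g r j)" by (simp add: Bset_def finite_Nk)
        show "\<alpha> i < card (T i)" if "\<alpha> \<in> Bset g r j" for \<alpha> i
          using le_tdeg[of \<alpha> i] that by (simp add: T Bset_def Nk_def)
      qed (use zero in \<open>auto simp: X_def\<close>)
      with v show False by blast
    qed
    then obtain x where x: "x \<in> X" "(\<Sum>a\<in>Bset g r j. v a * monomial_at a x) \<noteq> 0" by blast
    have pos': "0 < peval (gg g j) x" if "x \<in> X" for x
      using pos[OF _ j] that T(3) by (auto simp: X_def)
    have "0 < (\<Sum>x\<in>X. peval (gg g j) x * (\<Sum>a\<in>Bset g r j. v a * monomial_at a x)\<^sup>2)"
      by (rule sum_pos2[OF \<open>finite X\<close> x(1)]) (use pos' x in \<open>auto simp: less_imp_le\<close>)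
    then show "0 < quad_form (Bset g r j) (locmat g j y) v"
      using \<open>N > 0\<close> by (simp add: form)
  qed
qed

section \<open>The graphs of the hierarchy\<close>

text \<open>Single units are moved into \<open>\<beta>\<close> until the rest has degree at most
  \<open>l\<close>. With both bounds equal to \<open>r\<close> this writes each exponent of
  \<open>f\<close> as a sum of two basis exponents.\<close>

lemma exists_split_exponent:
  fixes \<alpha> :: "('n::finite) expo"
  assumes "tdeg \<alpha> \<le> k + l"
  shows "\<exists>\<beta> \<gamma>. addexp \<beta> \<gamma> = \<alpha> \<and> tdeg \<beta> \<le> k \<and> tdeg \<gamma> \<le> l"
  using assms
proof (induction k arbitrary: \<alpha>)
  case 0
  then show ?case by (intro exI[of _ zexp] exI[of _ \<alpha>]) (simp add: addexp_def zexp_def tdeg_def)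
next
  case (Suc k)
  show ?case
  proof (cases "tdeg \<alpha> \<le> k + l")
    case True
    then show ?thesis using Suc.IH[of \<alpha>] le_SucI by blast
  next
    case False
    then obtain i where i: "\<alpha> i \<noteq> 0" by (fastforce simp: tdeg_def)
    define e :: "'n expo" where "e = zexp(i := 1)"
    define \<alpha>' where "\<alpha>' = \<alpha>(i := \<alpha> i - 1)"
    have tdeg_addexp: "tdeg (addexp a b) = tdeg a + tdeg b" for a b :: "'n expo"
      by (simp add: tdeg_def addexp_def sum.distrib)
    have e: "tdeg e = 1" by (simp add: tdeg_def e_def zexp_def)
    have split: "addexp e \<alpha>' = \<alpha>" using i by (auto simp: addexp_def e_def \<alpha>'_def zexp_def)
    then have "tdeg \<alpha>' \<le> k + l" using Suc.prems tdeg_addexp[of e \<alpha>'] e by simp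
    then obtain \<beta> \<gamma> where "addexp \<beta> \<gamma> = \<alpha>'" "tdeg \<beta> \<le> k" "tdeg \<gamma> \<le> l"
      using Suc.IH by blast
    then have "addexp (addexp e \<beta>) \<gamma> = \<alpha>" "tdeg (addexp e \<beta>) \<le> Suc k"
      using split e tdeg_addexp[of e \<beta>] by (simp_all add: addexp_assoc)
    with \<open>tdeg \<gamma> \<le> l\<close> show ?thesis by blast
  qed
qed

section \<open>Supports, basis sets and monotonicity of the graphs\<close>

lemma psupp_gg_0: "psupp (gg g 0) = {zexp}"
  by (simp add: gg_def one_poly_def psupp_xmon)

lemma zexp_in_Nk: "zexp \<in> Nk k"
  by (simp add: Nk_def tdeg_def zexp_def)

lemma msumset_zexp: "msumset {zexp} S = S"
  by (auto simp: msumset_def addexp_zexp)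

lemma msumset_mono: "T \<subseteq> T' \<Longrightarrow> msumset S T \<subseteq> msumset S T'"
  unfolding msumset_def by blast

lemma gsupp_mono: "subgraph G H \<Longrightarrow> gsupp G \<subseteq> gsupp H"
  unfolding subgraph_def gsupp_def by blast

lemma wf_graph_Fgraph: "wf_graph (Fgraph g m r Gp j)"
  unfolding wf_graph_def Fgraph_def gnodes_def gedges_def by auto

lemma gnodes_Fgraph: "gnodes (Fgraph g m r Gp j) = Bset g r j"
  by (simp add: Fgraph_def gnodes_def)

lemma Bset_mono: "r \<le> r' \<Longrightarrow> Bset g r j \<subseteq> Bset g r' j"
  by (auto simp: Bset_def Nk_def)

lemma finite_Bset: "finite (Bset g r j)"
  by (simp add: Bset_def finite_Nk)

text \<open>\<open>G0\<close> and \<open>Fgraph\<close> both have edge sets of this shape, so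
  comparing such graphs reduces to comparing edge conditions.\<close>

lemma subgraph_edge_comprehension:
  assumes "V \<subseteq> V'" "\<And>b c. b \<in> V \<Longrightarrow> c \<in> V \<Longrightarrow> b \<noteq> c \<Longrightarrow> P b c \<Longrightarrow> P' b c"
  shows "subgraph (V, {{b, c} | b c. b \<in> V \<and> c \<in> V \<and> b \<noteq> c \<and> P b c})
                  (V', {{b, c} | b c. b \<in> V' \<and> c \<in> V' \<and> b \<noteq> c \<and> P' b c})"
  using assms unfolding subgraph_def gnodes_def gedges_def fst_conv snd_conv by blast

lemma subgraph_Fgraph:
  assumes "r \<le> r'" "\<And>i. subgraph (Gp i) (Gp' i)"
  shows "subgraph (Fgraph g m r Gp j) (Fgraph g m r' Gp' j)"
proof -
  have "(\<Union>i\<in>{0..m}. msumset (psupp (gg g i)) (gsupp (Gp i)))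
      \<subseteq> (\<Union>i\<in>{0..m}. msumset (psupp (gg g i)) (gsupp (Gp' i)))"
    using assms(2) by (intro UN_mono order_refl msumset_mono gsupp_mono)
  then show ?thesis
    unfolding Fgraph_def by (intro subgraph_edge_comprehension Bset_mono[OF assms(1)]) blast
qed

lemma subgraph_chordal_ext_op:
  "chordal_ext_op ext \<Longrightarrow> wf_graph G \<Longrightarrow> wf_graph H \<Longrightarrow> subgraph G H \<Longrightarrow> subgraph (ext G) (ext H)"
  unfolding chordal_ext_op_def by blast

lemma subgraph_ext: "chordal_ext_op ext \<Longrightarrow> wf_graph G \<Longrightarrow> subgraph G (ext G)"
  unfolding chordal_ext_op_def subgraph_def by blast

lemma wf_graph_ext: "chordal_ext_op ext \<Longrightarrow> wf_graph G \<Longrightarrow> wf_graph (ext G)"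
  unfolding chordal_ext_op_def by blast

lemma gnodes_ext: "chordal_ext_op ext \<Longrightarrow> wf_graph G \<Longrightarrow> gnodes (ext G) = gnodes G"
  unfolding chordal_ext_op_def by blast

lemma subgraph_trans: "subgraph G H \<Longrightarrow> subgraph H K \<Longrightarrow> subgraph G K"
  unfolding subgraph_def by blast

lemma wf_graph_tsg:
  assumes "chordal_ext_op ext"
  shows "wf_graph (tsg ext f g m r s j)"
proof (cases s)
  case 0
  then show ?thesis unfolding wf_graph_def by (auto simp: G0_def gnodes_def gedges_def)
next
  case (Suc s)
  then show ?thesis by (simp add: wf_graph_ext[OF assms wf_graph_Fgraph])
qed

lemma gnodes_tsg:
  assumes "chordal_ext_op ext"
  shows "gnodes (tsg ext f g m r s j) = Bset g r j"
proof (cases s)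
  case 0
  then show ?thesis by (simp add: G0_def gnodes_def)
next
  case (Suc s)
  then show ?thesis by (simp add: gnodes_ext[OF assms wf_graph_Fgraph] gnodes_Fgraph)
qed

text \<open>Base case of monotonicity in the sparse order, separate because the initial graphs do
  not arise from \<open>Fgraph\<close>. For \<open>j = 0\<close> the multiplier is the constant 1,
  so the exponent of an edge lies in the support itself; the other initial graphs are
  edgeless.\<close>

lemma subgraph_tsg_0_Fgraph: "subgraph (tsg ext f g m r 0 j) (Fgraph g m r (tsg ext f g m r 0) j)"
proof (cases "j = 0")
  case True
  have "subgraph (G0 f g m r) (Fgraph g m r (tsg ext f g m r 0) 0)"
    unfolding Fgraph_def
  proof (subst G0_def, rule subgraph_edge_comprehension[OF order_refl])
    fix b c
    assume "b \<in> Bset g r 0" "c \<in> Bset g r 0" "b \<noteq> c"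
      "addexp b c \<in> Aset f g m \<union> (\<lambda>a. addexp a a) ` Bset g r 0"
    then have "{b, c} \<in> gedges (tsg ext f g m r 0 0)"
      unfolding tsg.simps(1) G0_def gedges_def if_True simp_thms snd_conv by blast
    then have "addexp b c \<in> msumset (psupp (gg g 0)) (gsupp (tsg ext f g m r 0 0))"
      unfolding psupp_gg_0 msumset_zexp gsupp_def by blast
    then have "addexp b c \<in> (\<Union>i\<in>{0..m}. msumset (psupp (gg g i)) (gsupp (tsg ext f g m r 0 i)))"
      by (rule UN_I[rotated]) simp
    then show "msumset (psupp (gg g 0)) {addexp b c} \<inter>
        (\<Union>i\<in>{0..m}. msumset (psupp (gg g i)) (gsupp (tsg ext f g m r 0 i))) \<noteq> {}"
      unfolding psupp_gg_0 msumset_zexp by blast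
  qed
  with True show ?thesis by simp
qed (simp add: subgraph_def Fgraph_def gnodes_def gedges_def)

lemma subgraph_tsg_Suc:
  assumes "chordal_ext_op ext"
  shows "subgraph (tsg ext f g m r s j) (tsg ext f g m r (Suc s) j)"
proof (induction s arbitrary: j)
  case 0
  show ?case
    using subgraph_trans[OF subgraph_tsg_0_Fgraph subgraph_ext[OF assms wf_graph_Fgraph]]
    by (subst tsg.simps(2))
next
  case (Suc s)
  have "subgraph (Fgraph g m r (tsg ext f g m r s) j) (Fgraph g m r (tsg ext f g m r (Suc s)) j)"
    by (rule subgraph_Fgraph[OF order_refl Suc.IH])
  then have "subgraph (ext (Fgraph g m r (tsg ext f g m r s) j))
      (ext (Fgraph g m r (tsg ext f g m r (Suc s)) j))"
    by (rule subgraph_chordal_ext_op[OF assms wf_graph_Fgraph wf_graph_Fgraph])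
  then show ?case by (simp only: tsg.simps(2))
qed

lemma subgraph_tsg_order:
  assumes "chordal_ext_op ext" "r \<le> r'"
  shows "subgraph (tsg ext f g m r s j) (tsg ext f g m r' s j)"
proof (induction s arbitrary: j)
  case 0
  have "subgraph (G0 f g m r) (G0 f g m r')"
    unfolding G0_def
    using Bset_mono[OF assms(2), of g 0] by (intro subgraph_edge_comprehension) blast+
  moreover have "subgraph (Bset g r j, {}) (Bset g r' j, {})"
    using Bset_mono[OF assms(2)] by (simp add: subgraph_def gnodes_def gedges_def)
  ultimately show ?case by simp
next
  case (Suc s)
  then show ?case
    using subgraph_chordal_ext_op[OF assms(1) wf_graph_Fgraph wf_graph_Fgraph
        subgraph_Fgraph[OF assms(2) Suc.IH]]
    by (simp only: tsg.simps(2))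
qed

lemma subgraph_tsg_le:
  assumes "chordal_ext_op ext" "s \<le> s'"
  shows "subgraph (tsg ext f g m r s j) (tsg ext f g m r s' j)"
  using assms(2)
proof (induction rule: dec_induct)
  case base
  show ?case by (simp add: subgraph_def)
next
  case (step n)
  then show ?case using subgraph_trans subgraph_tsg_Suc[OF assms(1)] by blast
qed

text \<open>The order bound lets each exponent of \<open>f\<close> split into two basis exponents,
  and these are equal or adjacent in \<open>G0\<close> because \<open>Aset\<close> contains the
  exponents of \<open>f\<close>. Hence the objective involves only moments that the constraints
  see.\<close>

lemma psupp_subset_gsupp_tsg:
  assumes "finite (psupp f)" "chordal_ext_op ext" "rmin f g m \<le> r"
  shows "psupp f \<subseteq> gsupp (tsg ext f g m r s 0)"
proof -
  have "psupp f \<subseteq> gsupp (G0 f g m r)"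
  proof
    fix \<alpha> assume \<alpha>: "\<alpha> \<in> psupp f"
    have "tdeg \<alpha> \<le> pdeg f"
      using \<alpha> assms(1) unfolding pdeg_def by (intro Max_ge) auto
    moreover have "nat \<lceil>real (pdeg f) / 2\<rceil> \<le> r"
      using assms(3) unfolding rmin_def by simp
    then have "pdeg f \<le> r + r" by linarith
    ultimately obtain \<beta> \<gamma> where \<beta>\<gamma>: "addexp \<beta> \<gamma> = \<alpha>" "tdeg \<beta> \<le> r" "tdeg \<gamma> \<le> r"
      using exists_split_exponent[of \<alpha> r r] by fastforce
    then have B: "\<beta> \<in> Bset g r 0" "\<gamma> \<in> Bset g r 0"
      by (auto simp: Bset_def Nk_def dj_def)
    have "\<beta> = \<gamma> \<or> {\<beta>, \<gamma>} \<in> gedges (G0 f g m r)"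
      using B \<beta>\<gamma>(1) \<alpha> by (auto simp: G0_def gedges_def Aset_def)
    then show "\<alpha> \<in> gsupp (G0 f g m r)"
      using \<beta>\<gamma>(1) B by (auto simp: gsupp_def G0_def gnodes_def)
  qed
  also have "\<dots> \<subseteq> gsupp (tsg ext f g m r s 0)"
    using gsupp_mono[OF subgraph_tsg_le[OF assms(2), of 0 s f g m r 0]] by simp
  finally show ?thesis .
qed

text \<open>Index set of the dual equations and, at the same time, the set of moments occurring in
  retained entries of the localizing matrices.\<close>

definition ts_support where
  "ts_support ext f g m r s =
     (\<Union>i\<in>{0..m}. msumset (psupp (gg g i)) (gsupp (tsg ext f g m r s i)))"

lemma gsupp_subset_ts_support: "gsupp (tsg ext f g m r s 0) \<subseteq> ts_support ext f g m r s"
proof -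
  have "gsupp (tsg ext f g m r s 0) = msumset (psupp (gg g 0)) (gsupp (tsg ext f g m r s 0))"
    by (simp only: psupp_gg_0 msumset_zexp)
  also have "\<dots> \<subseteq> ts_support ext f g m r s" unfolding ts_support_def by (rule UN_upper) simp
  finally show ?thesis .
qed

lemma psupp_subset_ts_support:
  assumes "finite (psupp f)" "chordal_ext_op ext" "rmin f g m \<le> r"
  shows "psupp f \<subseteq> ts_support ext f g m r s"
  using psupp_subset_gsupp_tsg[OF assms] gsupp_subset_ts_support by (rule order_trans)

lemma zexp_in_ts_support:
  assumes "chordal_ext_op ext"
  shows "zexp \<in> ts_support ext f g m r s"
proof -
  have "zexp \<in> gsupp (tsg ext f g m r s 0)"
    unfolding gsupp_def gnodes_tsg[OF assms] Bset_def
    by (rule CollectI, rule exI[of _ zexp], rule exI[of _ zexp]) (simp add: addexp_zexp zexp_in_Nk)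
  then show ?thesis using gsupp_subset_ts_support by blast
qed

text \<open>Off the pattern both sides are masked to 0, so what remains is a semidefinite completion
  of the entries on the diagonal and the edges.\<close>

lemma in_proj_psd_had_prod_Bmat:
  "in_proj_psd G (had_prod (Bmat G) M) \<longleftrightarrow>
    (\<exists>Q. psd_on (gnodes G) Q \<and>
      (\<forall>a\<in>gnodes G. \<forall>b\<in>gnodes G. a = b \<or> {a, b} \<in> gedges G \<longrightarrow> M a b = Q a b))"
  unfolding in_proj_psd_def had_prod_def Bmat_def projG_def
  by (intro arg_cong[where f = Ex] ext) auto

lemma in_proj_psd_subgraph:
  assumes "in_proj_psd H (had_prod (Bmat H) M)" "subgraph G H" "finite (gnodes H)"
  shows "in_proj_psd G (had_prod (Bmat G) M)"
proof -
  obtain Q where "psd_on (gnodes H) Q"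
    "\<forall>a\<in>gnodes H. \<forall>b\<in>gnodes H. a = b \<or> {a, b} \<in> gedges H \<longrightarrow> M a b = Q a b"
    using assms(1) unfolding in_proj_psd_had_prod_Bmat by blast
  moreover from this(1) have "psd_on (gnodes G) Q"
    by (rule psd_on_subset) (use assms in \<open>auto simp: subgraph_def\<close>)
  ultimately show ?thesis
    using assms(2) unfolding in_proj_psd_had_prod_Bmat subgraph_def by blast
qed

text \<open>A completion for the larger graphs restricts to a principal submatrix with fewer
  prescribed entries. Both \<open>r\<close> and \<open>s\<close> may change, so the lemma serves
  both hierarchies.\<close>

lemma ts_val_mono:
  assumes "chordal_ext_op ext"
    and "\<And>j. subgraph (tsg ext f g m r s j) (tsg ext f g m r' s' j)"
  shows "ts_val ext f g m r s \<le> ts_val ext f g m r' s'"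
  unfolding ts_val_def
proof (rule INF_superset_mono)
  show "{y. ts_feasible ext f g m r' s' y} \<subseteq> {y. ts_feasible ext f g m r s y}"
  proof (clarify)
    fix y assume y: "ts_feasible ext f g m r' s' y"
    show "ts_feasible ext f g m r s y"
      unfolding ts_feasible_def
    proof (intro conjI ballI)
      show "y zexp = 1" using y unfolding ts_feasible_def by blast
      fix j assume "j \<in> {0..m}"
      then have "in_proj_psd (tsg ext f g m r' s' j)
          (had_prod (Bmat (tsg ext f g m r' s' j)) (locmat g j y))"
        using y unfolding ts_feasible_def by blast
      then show "in_proj_psd (tsg ext f g m r s j) (had_prod (Bmat (tsg ext f g m r s j)) (locmat g j y))"
        by (rule in_proj_psd_subgraph[OF _ assms(2)]) (simp only: gnodes_tsg[OF assms(1)] finite_Bset)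
    qed
  qed
qed auto

lemma ts_val_le_mom_val:
  assumes "chordal_ext_op ext"
  shows "ts_val ext f g m r s \<le> mom_val f g m r"
  unfolding ts_val_def mom_val_def
proof (rule INF_superset_mono)
  show "{y. mom_feasible g m r y} \<subseteq> {y. ts_feasible ext f g m r s y}"
    unfolding mom_feasible_def ts_feasible_def in_proj_psd_had_prod_Bmat gnodes_tsg[OF assms]
    by blast
qed auto

section \<open>Stabilization\<close>

text \<open>Strict growth from index 1 on would add an element at every step and outgrow
  \<open>U\<close>. The bound \<open>1 \<le> s\<close> ensures that the stable graphs are themselves
  results of the extension operation.\<close>

lemma increasing_sets_stabilize:
  assumes "finite U" "\<And>s::nat. E s \<subseteq> U" "\<And>s. E s \<subseteq> E (Suc s)"
  shows "\<exists>s\<ge>1. E (Suc s) = E s"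
proof (rule ccontr)
  assume "\<not> ?thesis"
  then have strict: "E s \<subset> E (Suc s)" if "s \<ge> 1" for s using assms(3)[of s] that by blast
  have fin: "finite (E s)" for s using assms(1,2) finite_subset by blast
  have "s \<le> card (E (Suc s))" for s
  proof (induction s)
    case (Suc s)
    have "card (E (Suc s)) < card (E (Suc (Suc s)))"
      by (intro psubset_card_mono fin strict) simp
    with Suc.IH show ?case by simp
  qed simp
  from this[of "Suc (card U)"] card_mono[OF assms(1,2), of "Suc (Suc (card U))"]
  show False by simp
qed

text \<open>Together with the diagonal, adjacency is the equivalence of lying in one component. The
  set of reachable nodes names the component and serves as the colour in
  \<open>psd_on_blocks\<close>.\<close>

lemma edge_max_chordal_ext_iff:
  assumes "a \<in> gnodes G" "b \<in> gnodes G"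
  shows "a = b \<or> {a, b} \<in> gedges (max_chordal_ext G) \<longleftrightarrow> (adjrel G)\<^sup>* `` {a} = (adjrel G)\<^sup>* `` {b}"
proof -
  have sym: "sym ((adjrel G)\<^sup>*)"
    by (intro sym_rtrancl) (auto simp: sym_def adjrel_def insert_commute)
  have "{a, b} \<in> gedges (max_chordal_ext G) \<longleftrightarrow> a \<noteq> b \<and> (a, b) \<in> (adjrel G)\<^sup>*"
    using assms symD[OF sym] unfolding max_chordal_ext_def gedges_def snd_conv
    by (auto simp: doubleton_eq_iff)
  moreover have "(adjrel G)\<^sup>* `` {a} = (adjrel G)\<^sup>* `` {b} \<longleftrightarrow> (a, b) \<in> (adjrel G)\<^sup>*"
  proof
    assume "(adjrel G)\<^sup>* `` {a} = (adjrel G)\<^sup>* `` {b}"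
    moreover have "b \<in> (adjrel G)\<^sup>* `` {b}" by simp
    ultimately show "(a, b) \<in> (adjrel G)\<^sup>*" by (metis Image_singleton_iff)
  next
    assume ab: "(a, b) \<in> (adjrel G)\<^sup>*"
    show "(adjrel G)\<^sup>* `` {a} = (adjrel G)\<^sup>* `` {b}"
      using ab symD[OF sym ab] by (blast intro: rtrancl_trans)
  qed
  ultimately show ?thesis by blast
qed

lemma edge_Fgraph_iff:
  assumes "b \<in> Bset g r j" "c \<in> Bset g r j" "b \<noteq> c"
  shows "{b, c} \<in> gedges (Fgraph g m r (tsg ext f g m r s) j) \<longleftrightarrow>
    msumset (psupp (gg g j)) {addexp b c} \<inter> ts_support ext f g m r s \<noteq> {}"
  using assms unfolding Fgraph_def gedges_def snd_conv ts_support_def[symmetric]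
  by (auto simp: doubleton_eq_iff addexp_commute)

lemma exponents_in_ts_support:
  assumes "chordal_ext_op ext" "j \<in> {0..m}" "a \<in> Bset g r j"
    "a = b \<or> {a, b} \<in> gedges (tsg ext f g m r s j)"
  shows "msumset (psupp (gg g j)) {addexp a b} \<subseteq> ts_support ext f g m r s"
proof -
  have "addexp a b \<in> gsupp (tsg ext f g m r s j)"
    unfolding gsupp_def gnodes_tsg[OF assms(1)] using assms(3,4) by blast
  then have "msumset (psupp (gg g j)) {addexp a b} \<subseteq> msumset (psupp (gg g j)) (gsupp (tsg ext f g m r s j))"
    by (intro msumset_mono) simp
  then show ?thesis unfolding ts_support_def using assms(2) by blast
qed

lemma locmat_cong:
  assumes "\<And>w. w \<in> msumset (psupp (gg g j)) {addexp a b} \<Longrightarrow> y w = y' w"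
  shows "locmat g j y a b = locmat g j y' a b"
  unfolding locmat_eq
proof (rule sum.cong[OF refl])
  fix \<delta> assume "\<delta> \<in> psupp (gg g j)"
  then have "addexp (addexp a b) \<delta> \<in> msumset (psupp (gg g j)) {addexp a b}"
    unfolding msumset_def addexp_commute[of "addexp a b"] by blast
  then show "gg g j \<delta> * y (addexp (addexp a b) \<delta>) = gg g j \<delta> * y' (addexp (addexp a b) \<delta>)"
    using assms by simp
qed

lemma locmat_zero: "locmat g j (\<lambda>_. 0) a b = 0"
  by (simp add: locmat_eq)

text \<open>Once the graphs are stable, all exponents of an entry off the cliques lie outside the support,
  so truncating a feasible vector to the support turns every localizing matrix into a block-diagonal
  one whose blocks are positive semidefinite.\<close>

lemma mom_feasible_if_stable:
  fixes f :: "('n::finite) rpoly"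
  assumes ext: "chordal_ext_op (max_chordal_ext :: 'n expo graph \<Rightarrow> _)"
    and stable: "\<And>j. j \<in> {0..m} \<Longrightarrow> gedges (tsg max_chordal_ext f g m r (Suc (Suc s)) j)
      = gedges (tsg max_chordal_ext f g m r (Suc s) j)"
    and y: "ts_feasible max_chordal_ext f g m r (Suc s) y"
  shows "mom_feasible g m r (\<lambda>\<alpha>. if \<alpha> \<in> ts_support max_chordal_ext f g m r (Suc s) then y \<alpha> else 0)"
    (is "mom_feasible g m r ?y")
  unfolding mom_feasible_def
proof (intro conjI ballI)
  show "?y zexp = 1"
    using y zexp_in_ts_support[OF ext] by (simp add: ts_feasible_def)
  fix j assume j: "j \<in> {0..m}"
  define F where "F = Fgraph g m r (tsg max_chordal_ext f g m r s) j"
  define G where "G = tsg max_chordal_ext f g m r (Suc s) j"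
  have GF: "G = max_chordal_ext F" by (simp add: G_def F_def)
  have nodes: "gnodes F = Bset g r j" by (simp add: F_def gnodes_Fgraph)
  have nodesG: "gnodes G = Bset g r j" unfolding G_def by (rule gnodes_tsg[OF ext])
  define c where "c a = (adjrel F)\<^sup>* `` {a}" for a
  have "in_proj_psd G (had_prod (Bmat G) (locmat g j y))"
    using y j unfolding ts_feasible_def G_def by blast
  then obtain Q where Q: "psd_on (Bset g r j) Q"
    "\<And>a b. a \<in> Bset g r j \<Longrightarrow> b \<in> Bset g r j \<Longrightarrow> a = b \<or> {a, b} \<in> gedges G \<Longrightarrow> locmat g j y a b = Q a b"
    unfolding in_proj_psd_had_prod_Bmat nodesG by blast
  show "psd_on (Bset g r j) (locmat g j ?y)"
  proof (rule psd_on_cong[OF psd_on_blocks[OF finite_Bset Q(1), of c]])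
    fix a b assume ab: "a \<in> Bset g r j" "b \<in> Bset g r j"
    have iff: "c a = c b \<longleftrightarrow> a = b \<or> {a, b} \<in> gedges G"
      unfolding GF c_def by (rule edge_max_chordal_ext_iff[symmetric]) (use ab nodes in auto)
    show "locmat g j ?y a b = (if c a = c b then Q a b else 0)"
    proof (cases "c a = c b")
      case True
      then have edge: "a = b \<or> {a, b} \<in> gedges G" using iff by blast
      have "locmat g j ?y a b = locmat g j y a b"
        by (rule locmat_cong) (use exponents_in_ts_support[OF ext j ab(1) edge[unfolded G_def]] in auto)
      then show ?thesis using Q(2)[OF ab edge] True by simp
    next
      case False
      then have "a \<noteq> b" and "{a, b} \<notin> gedges G" using iff by auto
      \<comment> \<open>By stability the edges of \<open>G\<close> are those of the next extension,
        which contains the next \<open>Fgraph\<close>. A non-edge of \<open>G\<close> therefore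
        fails the edge test against exactly the support used for the truncation.\<close>
      moreover have "gedges (Fgraph g m r (tsg max_chordal_ext f g m r (Suc s)) j) \<subseteq> gedges G"
        using subgraph_ext[OF ext wf_graph_Fgraph, of g m r "tsg max_chordal_ext f g m r (Suc s)" j]
          stable[OF j] unfolding subgraph_def G_def by (simp only: tsg.simps(2))
      ultimately have "msumset (psupp (gg g j)) {addexp a b} \<inter> ts_support max_chordal_ext f g m r (Suc s) = {}"
        using edge_Fgraph_iff[OF ab] by blast
      then have "locmat g j ?y a b = locmat g j (\<lambda>_. 0) a b"
        by (intro locmat_cong) auto
      then show ?thesis using False by (simp add: locmat_zero)
    qed
  qed
qed

lemma Lfun_cong: "(\<And>\<alpha>. \<alpha> \<in> psupp f \<Longrightarrow> y \<alpha> = y' \<alpha>) \<Longrightarrow> Lfun y f = Lfun y' f"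
  by (simp add: Lfun_def)

text \<open>The edge sets for all \<open>j\<close> are packed into one dependent sum, so that a
  single index stabilizes them simultaneously.\<close>

lemma tsg_stabilizes:
  assumes "chordal_ext_op ext"
  shows "\<exists>s\<ge>1. \<forall>j\<in>{0..m}. gedges (tsg ext f g m r (Suc s) j) = gedges (tsg ext f g m r s j)"
proof -
  define E where "E s = Sigma {0..m} (\<lambda>j. gedges (tsg ext f g m r s j))" for s
  have "\<exists>s\<ge>1. E (Suc s) = E s"
  proof (rule increasing_sets_stabilize)
    show "finite (Sigma {0..m} (\<lambda>j. Pow (Bset g r j)))"
      by (intro finite_SigmaI finite_Pow_iff[THEN iffD2] finite_Bset finite_atLeastAtMost)
    show "E s \<subseteq> Sigma {0..m} (\<lambda>j. Pow (Bset g r j))" for s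
      unfolding E_def
    proof (rule Sigma_mono[OF order_refl])
      show "gedges (tsg ext f g m r s j) \<subseteq> Pow (Bset g r j)" for j
        using wf_graph_tsg[OF assms, of f g m r s j]
        unfolding wf_graph_def gnodes_tsg[OF assms] by fastforce
    qed
    show "E s \<subseteq> E (Suc s)" for s
      unfolding E_def using subgraph_tsg_Suc[OF assms, of f g m r s]
      by (intro Sigma_mono order_refl) (simp only: subgraph_def)
  qed
  then obtain s where s: "s \<ge> 1" "E (Suc s) = E s" by blast
  have "gedges (tsg ext f g m r s j) = E s `` {j}" if "j \<in> {0..m}" for s j
    unfolding E_def using that by blast
  with s show ?thesis by metis
qed

lemma ts_val_eq_mom_val:
  fixes f :: "('n::finite) rpoly"
  assumes ext: "chordal_ext_op (max_chordal_ext :: 'n expo graph \<Rightarrow> _)" and "finite (psupp f)" "rmin f g m \<le> r"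
  shows "\<exists>s\<ge>1. ts_val max_chordal_ext f g m r s = mom_val f g m r"
proof -
  obtain s' where s': "s' \<ge> 1" "\<And>j. j \<in> {0..m} \<Longrightarrow>
      gedges (tsg max_chordal_ext f g m r (Suc s') j) = gedges (tsg max_chordal_ext f g m r s' j)"
    using tsg_stabilizes[OF ext] by blast
  then obtain s where s: "s' = Suc s" by (cases s') auto
  note stable = s'(2)[unfolded s]
  have "mom_val f g m r \<le> ts_val max_chordal_ext f g m r s'"
    unfolding ts_val_def
  proof (rule INF_greatest, clarify)
    fix y assume y: "ts_feasible max_chordal_ext f g m r s' y"
    let ?W = "ts_support max_chordal_ext f g m r (Suc s)"
    let ?y = "\<lambda>\<alpha>. if \<alpha> \<in> ?W then y \<alpha> else 0"
    have "mom_feasible g m r ?y"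
      using y unfolding s by (intro mom_feasible_if_stable[OF ext stable])
    then have "mom_val f g m r \<le> ereal (Lfun ?y f)"
      unfolding mom_val_def by (intro INF_lower) simp
    \<comment> \<open>Truncation does not affect the objective, since the support contains every
      exponent of \<open>f\<close>.\<close>
    also have "Lfun ?y f = Lfun y f"
      using psupp_subset_ts_support[OF assms(2) ext assms(3), of "Suc s"] by (intro Lfun_cong) auto
    finally show "mom_val f g m r \<le> ereal (Lfun y f)" .
  qed
  with ts_val_le_mom_val[OF ext, of f g m r s'] s'(1) show ?thesis
    by (intro exI[of _ s']) auto
qed

section \<open>Duality\<close>

definition graph_pairs :: "'a graph \<Rightarrow> ('a \<times> 'a) set" where
  "graph_pairs G = {(a, b). a \<in> gnodes G \<and> b \<in> gnodes G \<and> (a = b \<or> {a, b} \<in> gedges G)}"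

lemma psupp_gg_finite:
  "\<forall>j\<in>{1..m}. finite (psupp (g j)) \<Longrightarrow> j \<in> {0..m} \<Longrightarrow> finite (psupp (gg g j))"
  by (cases "j = 0") (auto simp: psupp_gg_0, auto simp: gg_def)

lemma finite_gsupp:
  assumes "wf_graph G" "finite (gnodes G)"
  shows "finite (gsupp G)"
proof (rule finite_subset)
  show "gsupp G \<subseteq> (\<lambda>(b, c). addexp b c) ` (gnodes G \<times> gnodes G)"
  proof
    fix \<alpha> assume "\<alpha> \<in> gsupp G"
    then obtain b c where bc: "\<alpha> = addexp b c" "b = c \<and> b \<in> gnodes G \<or> {b, c} \<in> gedges G"
      unfolding gsupp_def by blast
    then have "b \<in> gnodes G \<and> c \<in> gnodes G"
      using assms(1) unfolding wf_graph_def by (metis doubleton_eq_iff)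
    with bc(1) show "\<alpha> \<in> (\<lambda>(b, c). addexp b c) ` (gnodes G \<times> gnodes G)" by force
  qed
qed (use assms(2) in simp)

lemma finite_msumset: "finite S \<Longrightarrow> finite T \<Longrightarrow> finite (msumset S T)"
  unfolding msumset_def by (rule finite_image_set2) simp_all

lemma finite_ts_support:
  assumes "\<forall>j\<in>{1..m}. finite (psupp (g j))" "chordal_ext_op ext"
  shows "finite (ts_support ext f g m r s)"
  unfolding ts_support_def
proof (intro finite_UN_I finite_atLeastAtMost)
  fix i assume "i \<in> {0..m}"
  then have "finite (psupp (gg g i))" by (rule psupp_gg_finite[OF assms(1)])
  moreover have "finite (gsupp (tsg ext f g m r s i))"
    by (rule finite_gsupp[OF wf_graph_tsg[OF assms(2)]]) (simp only: gnodes_tsg[OF assms(2)] finite_Bset)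
  ultimately show "finite (msumset (psupp (gg g i)) (gsupp (tsg ext f g m r s i)))"
    by (rule finite_msumset)
qed

lemma Lfun_eq_sum:
  assumes "finite W" "psupp f \<subseteq> W"
  shows "Lfun y f = (\<Sum>w\<in>W. f w * y w)"
  unfolding Lfun_def by (rule sum.mono_neutral_left) (use assms in \<open>auto simp: psupp_def\<close>)

lemma locmat_eq_ts_support_sum:
  assumes "\<forall>j\<in>{1..m}. finite (psupp (g j))" "chordal_ext_op ext" "j \<in> {0..m}"
    and "(a, b) \<in> graph_pairs (tsg ext f g m r s j)"
  shows "locmat g j y a b = (\<Sum>w\<in>ts_support ext f g m r s. Cmat g j w a b * y w)"
proof (rule locmat_eq_Cmat)
  show "finite (psupp (gg g j))" by (rule psupp_gg_finite[OF assms(1,3)])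
  show "finite (ts_support ext f g m r s)" by (rule finite_ts_support[OF assms(1,2)])
  show "msumset (psupp (gg g j)) {addexp a b} \<subseteq> ts_support ext f g m r s"
    using assms(4) unfolding graph_pairs_def gnodes_tsg[OF assms(2)]
    by (intro exponents_in_ts_support[OF assms(2,3)]) auto
qed

lemma in_proj_psd_iff_graph_pairs:
  "in_proj_psd G (had_prod (Bmat G) M) \<longleftrightarrow>
    (\<exists>Q. psd_on (gnodes G) Q \<and> (\<forall>(a, b)\<in>graph_pairs G. M a b = Q a b))"
  unfolding in_proj_psd_had_prod_Bmat graph_pairs_def by (intro arg_cong[where f = Ex] HOL.ext) auto

lemma Cmat_sym: "Cmat g j w a b = Cmat g j w b a"
  by (simp add: Cmat_def addexp_commute)

text \<open>Inserting the dual equations into the objective leaves \<open>b\<close> plus pairings of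
  the \<open>Gs j\<close> with the localizing matrices. As \<open>Gs j\<close> vanishes off the
  pattern, the localizing matrix may be replaced by its semidefinite completion, which makes each
  pairing nonnegative.\<close>

lemma ts_weak_duality:
  assumes fin: "finite (psupp f)" "\<forall>j\<in>{1..m}. finite (psupp (g j))" and ext: "chordal_ext_op ext"
    and r: "rmin f g m \<le> r"
    and y: "ts_feasible ext f g m r s y" and dual: "ts_dual_feasible ext f g m r s Gs b"
  shows "b \<le> Lfun y f"
proof -
  define W where "W = ts_support ext f g m r s"
  have W: "finite W" "psupp f \<subseteq> W" "zexp \<in> W"
    unfolding W_def using finite_ts_support[OF fin(2) ext] psupp_subset_ts_support[OF fin(1) ext r]
      zexp_in_ts_support[OF ext] by auto
  have dual_eq: "f w = (\<Sum>j=0..m. frob (Bset g r j) (Cmat g j w) (Gs j)) + (if w = zexp then b else 0)"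
    if "w \<in> W" for w
  proof -
    have "(\<Sum>j=0..m. frob (Bset g r j) (Cmat g j w) (Gs j)) = f w - (if w = zexp then b else 0)"
      using dual that unfolding ts_dual_feasible_def W_def ts_support_def by blast
    then show ?thesis by simp
  qed
  have nonneg: "0 \<le> (\<Sum>w\<in>W. frob (Bset g r j) (Cmat g j w) (Gs j) * y w)" if j: "j \<in> {0..m}" for j
  proof -
    let ?G = "tsg ext f g m r s j" and ?B = "Bset g r j"
    have nodes: "gnodes ?G = ?B" by (rule gnodes_tsg[OF ext])
    have Gs: "psd_on ?B (Gs j)" "in_SG ?G (Gs j)"
      using dual j unfolding ts_dual_feasible_def by blast+
    have "in_proj_psd ?G (had_prod (Bmat ?G) (locmat g j y))"
      using y j unfolding ts_feasible_def by blast
    then obtain Q where Q: "psd_on ?B Q"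
      "\<And>a b. (a, b) \<in> graph_pairs ?G \<Longrightarrow> locmat g j y a b = Q a b"
      unfolding in_proj_psd_iff_graph_pairs nodes by blast
    have "(\<Sum>w\<in>W. frob ?B (Cmat g j w) (Gs j) * y w)
        = (\<Sum>w\<in>W. \<Sum>a\<in>?B. \<Sum>b\<in>?B. Cmat g j w a b * y w * Gs j b a)"
      unfolding frob_def sum_distrib_right by (simp add: mult_ac)
    also have "\<dots> = (\<Sum>a\<in>?B. \<Sum>w\<in>W. \<Sum>b\<in>?B. Cmat g j w a b * y w * Gs j b a)"
      by (rule sum.swap)
    also have "\<dots> = (\<Sum>a\<in>?B. \<Sum>b\<in>?B. \<Sum>w\<in>W. Cmat g j w a b * y w * Gs j b a)"
      by (intro sum.cong refl sum.swap)
    also have "\<dots> = mat_inner ?B Q (Gs j)"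
    proof (intro sum.cong refl)
      fix a b assume ab: "a \<in> ?B" "b \<in> ?B"
      have eq: "(\<Sum>w\<in>W. Cmat g j w a b * y w * Gs j b a) = (\<Sum>w\<in>W. Cmat g j w a b * y w) * Gs j a b"
        using psd_on_sym[OF Gs(1) ab] by (simp add: sum_distrib_right)
      show "(\<Sum>w\<in>W. Cmat g j w a b * y w * Gs j b a) = Q a b * Gs j a b"
      proof (cases "(a, b) \<in> graph_pairs ?G")
        case True
        have "(\<Sum>w\<in>W. Cmat g j w a b * y w) = Q a b"
          using locmat_eq_ts_support_sum[OF fin(2) ext j True, of y] Q(2)[OF True]
          unfolding W_def by simp
        then show ?thesis using eq by simp
      next
        case False
        then have "Gs j a b = 0"
          using Gs(2) ab unfolding in_SG_def graph_pairs_def nodes by blast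
        then show ?thesis using eq by simp
      qed
    qed
    also have "\<dots> \<ge> 0" by (rule psd_on_sum_prod_nonneg[OF finite_Bset Q(1) Gs(1)])
    finally show ?thesis .
  qed
  have "Lfun y f = (\<Sum>w\<in>W. f w * y w)" by (rule Lfun_eq_sum[OF W(1,2)])
  also have "\<dots> = (\<Sum>w\<in>W. (\<Sum>j=0..m. frob (Bset g r j) (Cmat g j w) (Gs j) * y w) + (if w = zexp then b * y w else 0))"
  proof (rule sum.cong[OF refl])
    fix w assume "w \<in> W"
    then show "f w * y w = (\<Sum>j=0..m. frob (Bset g r j) (Cmat g j w) (Gs j) * y w) + (if w = zexp then b * y w else 0)"
      by (subst dual_eq) (simp_all add: distrib_right sum_distrib_right)
  qed
  also have "\<dots> = (\<Sum>w\<in>W. \<Sum>j=0..m. frob (Bset g r j) (Cmat g j w) (Gs j) * y w) + b"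
    using W(1,3) y by (simp add: sum.distrib ts_feasible_def)
  also have "(\<Sum>w\<in>W. \<Sum>j=0..m. frob (Bset g r j) (Cmat g j w) (Gs j) * y w)
      = (\<Sum>j=0..m. \<Sum>w\<in>W. frob (Bset g r j) (Cmat g j w) (Gs j) * y w)"
    by (rule sum.swap)
  finally have "Lfun y f = (\<Sum>j=0..m. \<Sum>w\<in>W. frob (Bset g r j) (Cmat g j w) (Gs j) * y w) + b" .
  moreover have "0 \<le> (\<Sum>j=0..m. \<Sum>w\<in>W. frob (Bset g r j) (Cmat g j w) (Gs j) * y w)"
    by (rule sum_nonneg) (rule nonneg)
  ultimately show ?thesis by simp
qed

lemma ts_dual_solution:
  assumes fin: "finite (psupp f)" "\<forall>j\<in>{1..m}. finite (psupp (g j))" and ext: "chordal_ext_op ext"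
    and r: "rmin f g m \<le> r" and int: "interior (semialg_set g m) \<noteq> {}"
    and bound: "\<And>y. ts_feasible ext f g m r s y \<Longrightarrow> p \<le> Lfun y f"
  shows "\<exists>Gs b. ts_dual_feasible ext f g m r s Gs b \<and> p \<le> b"
proof -
  define W where "W = ts_support ext f g m r s"
  have W: "finite W" "psupp f \<subseteq> W" "zexp \<in> W"
    unfolding W_def using finite_ts_support[OF fin(2) ext] psupp_subset_ts_support[OF fin(1) ext r]
      zexp_in_ts_support[OF ext] by auto
  \<comment> \<open>a vanishing constraint polynomial gives no constraint, but would violate Slater's condition\<close>
  define J where "J = {j \<in> {0..m}. psupp (gg g j) \<noteq> {}}"
  define E where "E j = graph_pairs (tsg ext f g m r s j)" for j
  have nodes: "gnodes (tsg ext f g m r s j) = Bset g r j" for j by (rule gnodes_tsg[OF ext])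
  have Jm: "j \<in> {0..m}" if "j \<in> J" for j using that by (simp add: J_def)
  have lin: "(\<Sum>w\<in>W. Cmat g j w a b * y w) = locmat g j y a b" if "j \<in> J" "(a, b) \<in> E j" for j a b y
    unfolding W_def
    by (rule locmat_eq_ts_support_sum[OF fin(2) ext Jm[OF that(1)] that(2)[unfolded E_def], symmetric])
  obtain y0 where y0: "y0 zexp = 1"
    "\<And>j v. j \<in> J \<Longrightarrow> \<exists>a\<in>Bset g r j. v a \<noteq> 0 \<Longrightarrow> 0 < quad_form (Bset g r j) (locmat g j y0) v"
    using exists_strictly_feasible_moments[OF fin(2) int, of r] unfolding J_def by blast
  have "\<exists>H b. p \<le> b \<and> (\<forall>j\<in>J. psd_on (Bset g r j) (H j) \<and> (\<forall>a b. (a, b) \<notin> E j \<longrightarrow> H j a b = 0)) \<and>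
     (\<forall>w\<in>W. (\<Sum>j\<in>J. \<Sum>a\<in>Bset g r j. \<Sum>b\<in>Bset g r j. Cmat g j w a b * H j b a) = f w - (if w = zexp then b else 0))"
  \<comment> \<open>At the moments \<open>y0\<close> each full localizing matrix with index in
    \<open>J\<close> is positive definite, so it is its own completion.\<close>
  proof (rule conic_duality_dual_solution[where ?Q0.0 = "\<lambda>j. locmat g j y0" and ?y0.0 = y0
        and c = "\<lambda>j a b w. Cmat g j w a b"])
    show "E j \<subseteq> Bset g r j \<times> Bset g r j" for j
      unfolding E_def graph_pairs_def nodes by blast
    show "(b, a) \<in> E j" if "(a, b) \<in> E j" for j a b
      using that unfolding E_def graph_pairs_def by (auto simp: insert_commute)
    show "p \<le> (\<Sum>w\<in>W. f w * y w)" if y: "y zexp = 1"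
      "\<And>j. j \<in> J \<Longrightarrow> \<exists>Q. psd_on (Bset g r j) Q \<and> (\<forall>(a, b)\<in>E j. (\<Sum>w\<in>W. Cmat g j w a b * y w) = Q a b)" for y
    proof -
      have "ts_feasible ext f g m r s y"
        unfolding ts_feasible_def in_proj_psd_iff_graph_pairs nodes E_def[symmetric]
      proof (intro conjI ballI y(1))
        fix j assume j: "j \<in> {0..m}"
        show "\<exists>Q. psd_on (Bset g r j) Q \<and> (\<forall>(a, b)\<in>E j. locmat g j y a b = Q a b)"
        proof (cases "j \<in> J")
          case True
          with y(2)[OF True] lin[OF True] show ?thesis by (simp cong: ball_cong add: case_prod_beta)
        next
          case False
          then have "psupp (gg g j) = {}" using j by (simp add: J_def)
          then have "\<forall>(a, b)\<in>E j. locmat g j y a b = 0" by (simp add: locmat_eq)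
          moreover have "psd_on (Bset g r j) (\<lambda>a b. 0)" by (simp add: psd_on_def)
          ultimately show ?thesis by blast
        qed
      qed
      then show ?thesis using bound Lfun_eq_sum[OF W(1,2)] by metis
    qed
    show "finite J" by (simp add: J_def)
    show "finite (Bset g r j)" for j by (rule finite_Bset)
    show "Cmat g j w a b = Cmat g j w b a" for j a b w by (rule Cmat_sym)
  qed (use W y0 lin in simp_all)
  then obtain H b where H: "p \<le> b" "\<And>j. j \<in> J \<Longrightarrow> psd_on (Bset g r j) (H j)"
    "\<And>j a b. j \<in> J \<Longrightarrow> (a, b) \<notin> E j \<Longrightarrow> H j a b = 0"
    "\<And>w. w \<in> W \<Longrightarrow> (\<Sum>j\<in>J. \<Sum>a\<in>Bset g r j. \<Sum>b\<in>Bset g r j. Cmat g j w a b * H j b a)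
      = f w - (if w = zexp then b else 0)"
    by blast
  \<comment> \<open>Indices outside \<open>J\<close> get the zero matrix, so the dual sums over
    \<open>J\<close> and over all indices agree.\<close>
  define Gs where "Gs j = (if j \<in> J then H j else (\<lambda>_ _. 0))" for j
  have psd: "psd_on (Bset g r j) (Gs j)" for j
    using H(2) by (simp add: Gs_def psd_on_def)
  have "ts_dual_feasible ext f g m r s Gs b"
    unfolding ts_dual_feasible_def
  proof (intro conjI ballI psd)
    fix j assume "j \<in> {0..m}"
    show "in_SG (tsg ext f g m r s j) (Gs j)"
      unfolding in_SG_def nodes
    proof (intro conjI ballI impI)
      show "Gs j a b = Gs j b a" if "a \<in> Bset g r j" "b \<in> Bset g r j" for a b
        by (rule psd_on_sym[OF psd that])
      show "Gs j a b = 0" if "a \<noteq> b \<and> {a, b} \<notin> gedges (tsg ext f g m r s j)" for a b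
        using H(3)[of j a b] that by (simp add: Gs_def E_def graph_pairs_def)
    qed
  next
    fix w assume "w \<in> (\<Union>j\<in>{0..m}. msumset (psupp (gg g j)) (gsupp (tsg ext f g m r s j)))"
    then have "w \<in> W" unfolding W_def ts_support_def .
    have "(\<Sum>j=0..m. frob (Bset g r j) (Cmat g j w) (Gs j)) = (\<Sum>j\<in>J. frob (Bset g r j) (Cmat g j w) (H j))"
      by (rule sum.mono_neutral_cong_right) (auto simp: J_def Gs_def frob_def)
    then show "(\<Sum>j=0..m. frob (Bset g r j) (Cmat g j w) (Gs j)) = f w - (if w = zexp then b else 0)"
      using H(4)[OF \<open>w \<in> W\<close>] by (simp add: frob_def)
  qed
  with H(1) show ?thesis by blast
qed

text \<open>A real \<open>p\<close> strictly between the two values would be a primal lower bound,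
  hence reached by a dual point, contradicting the gap. Working with a real \<open>p\<close> treats
  infinite optimal values uniformly.\<close>

lemma ts_strong_duality:
  assumes "finite (psupp f)" "\<forall>j\<in>{1..m}. finite (psupp (g j))" "chordal_ext_op ext"
    and "rmin f g m \<le> r" "interior (semialg_set g m) \<noteq> {}"
  shows "ts_val ext f g m r s = ts_dual_val ext f g m r s"
proof (rule antisym)
  show "ts_dual_val ext f g m r s \<le> ts_val ext f g m r s"
    unfolding ts_dual_val_def ts_val_def
    using ts_weak_duality[OF assms(1-4)] by (intro SUP_least INF_greatest) auto
  show "ts_val ext f g m r s \<le> ts_dual_val ext f g m r s"
  proof (rule ccontr)
    assume "\<not> ?thesis"
    then have "ts_dual_val ext f g m r s < ts_val ext f g m r s" by simp
    from ereal_dense2[OF this] obtain p where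
      p: "ts_dual_val ext f g m r s < ereal p" "ereal p < ts_val ext f g m r s" by blast
    have "p \<le> Lfun y f" if "ts_feasible ext f g m r s y" for y
    proof -
      have "ts_val ext f g m r s \<le> ereal (Lfun y f)"
        unfolding ts_val_def using that by (intro INF_lower) simp
      with p(2) have "ereal p < ereal (Lfun y f)" by (rule less_le_trans)
      then show ?thesis by simp
    qed
    then obtain Gs b where "ts_dual_feasible ext f g m r s Gs b" "p \<le> b"
      using ts_dual_solution[OF assms] by blast
    then have "ereal p \<le> ts_dual_val ext f g m r s"
      unfolding ts_dual_val_def by (intro SUP_upper2[of "(Gs, b)"]) auto
    with p(1) show False by simp
  qed
qed

theorem theorem7p4:
  fixes f :: "('n::finite) rpoly" and g :: "nat \<Rightarrow> 'n rpoly" and m :: nat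
    and ext :: "'n expo graph \<Rightarrow> 'n expo graph"
  assumes "finite (psupp f)" and "\<forall>j\<in>{1..m}. finite (psupp (g j))"
    and "chordal_ext_op ext"
  shows
    "(interior (semialg_set g m) \<noteq> {} \<longrightarrow>
        (\<forall>r\<ge>rmin f g m. \<forall>s\<ge>1. ts_val ext f g m r s = ts_dual_val ext f g m r s))
     \<and> (\<forall>r\<ge>rmin f g m. (\<forall>s\<ge>1. ts_val ext f g m r s \<le> ts_val ext f g m r (s + 1)) \<and>
                        (\<forall>s\<ge>1. ts_val ext f g m r s \<le> mom_val f g m r))
     \<and> (ext = max_chordal_ext \<longrightarrow>
          (\<forall>r\<ge>rmin f g m. \<exists>s\<ge>1. ts_val ext f g m r s = mom_val f g m r))
     \<and> (\<forall>s\<ge>1. \<forall>r\<ge>rmin f g m. ts_val ext f g m r s \<le> ts_val ext f g m (r + 1) s)"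
proof (intro conjI impI allI)
  show "ts_val ext f g m r s = ts_dual_val ext f g m r s"
    if "interior (semialg_set g m) \<noteq> {}" "rmin f g m \<le> r" for r s
    by (rule ts_strong_duality[OF assms that(2,1)])
  show "ts_val ext f g m r s \<le> ts_val ext f g m r (s + 1)" for r s
    unfolding Suc_eq_plus1[symmetric]
    by (rule ts_val_mono[OF assms(3) subgraph_tsg_Suc[OF assms(3)]])
  show "ts_val ext f g m r s \<le> mom_val f g m r" for r s
    by (rule ts_val_le_mom_val[OF assms(3)])
  show "\<exists>s\<ge>1. ts_val ext f g m r s = mom_val f g m r"
    if "ext = max_chordal_ext" "rmin f g m \<le> r" for r
    unfolding that(1) by (rule ts_val_eq_mom_val[OF assms(3)[unfolded that(1)] assms(1) that(2)])
  show "ts_val ext f g m r s \<le> ts_val ext f g m (r + 1) s" for r s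
    by (intro ts_val_mono[OF assms(3)] subgraph_tsg_order[OF assms(3)]) simp
qed

end
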